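(* Let $a,b\in(0,\infty)$, $p\geq1$, and let $\mu_n$ ($n\in\mathbb{N}$) and $\mu$ be in $\mathcal{M}$. Then $W^{a,b}_p(\mu_n,\mu)\to0$ if and only if $\mu_n\rightharpoonup\mu$ weakly and the family $\{\mu_n\}$ is tight.
   Context: $\mathcal{M}$ is the space of positive Borel measures with finite mass on $\mathbb{R}^d$; $|\mu|$ is total variation. Weak convergence $\mu_n\rightharpoonup\mu$ means $\int f\,d\mu_n\to\int f\,d\mu$ for every continuous compactly supported $f$. A set of measures $S$ is tight if for every $\varepsilon>0$ there is a compact $K_\varepsilon$ with $m(\mathbb{R}^d\setminus K_\varepsilon)<\varepsilon$ for all $m\in S$. For $\mu,\nu$ with finite $p$-th moments and $|\mu|=|\nu|>0$, $W_p(\mu,\nu):=(|\mu|\min_\pi\int|x-y|^pd\pi(x,y))^{1/p}$, the minimum over probability measures $\pi$ on $\mathbb{R}^d\times\mathbb{R}^d$ with marginals $\mu/|\mu|$ and $\nu/|\nu|$; $W_p(0,0)=0$. $W^{a,b}_p(\mu,\nu):=\inf\{a|\mu-\tilde\mu|+a|\nu-\tilde\nu|+bW_p(\tilde\mu,\tilde\nu)\}$ over $\tilde\mu,\tilde\nu\in\mathcal{M}$ with finite $p$-th moments and $|\tilde\mu|=|\tilde\nu|$. *)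

theory Defs
  imports "HOL-Analysis.Analysis"
begin

definition finite_borel_measure :: "'a::euclidean_space measure \<Rightarrow> bool" where
  "finite_borel_measure m \<longleftrightarrow> sets m = sets borel \<and> emeasure m (space m) \<noteq> \<infinity>"

definition mass :: "'a::euclidean_space measure \<Rightarrow> real" where
  "mass m = measure m (space m)"

definition finite_moment :: "real \<Rightarrow> 'a::euclidean_space measure \<Rightarrow> bool" where
  "finite_moment p m \<longleftrightarrow> (\<integral>\<^sup>+ x. ennreal (norm x powr p) \<partial>m) < \<infinity>"

definition tv_dist :: "'a::euclidean_space measure \<Rightarrow> 'a measure \<Rightarrow> real" where
  "tv_dist m1 m2 = Sup {(\<Sum>A\<in>P. \<bar>measure m1 A - measure m2 A\<bar>) | P.
       finite P \<and> P \<subseteq> sets borel \<and> disjoint P}"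

definition couplings :: "'a::euclidean_space measure \<Rightarrow> 'a measure \<Rightarrow> ('a \<times> 'a) measure set" where
  "couplings m1 m2 = {\<pi>. emeasure \<pi> (space \<pi>) = 1 \<and> sets \<pi> = sets borel \<and>
      (\<forall>A\<in>sets borel. measure \<pi> (A \<times> UNIV) = measure m1 A / mass m1) \<and>
      (\<forall>A\<in>sets borel. measure \<pi> (UNIV \<times> A) = measure m2 A / mass m2)}"

text \<open>Unbalanced-mass-normalised Wasserstein distance W_p (for equal masses);
  W_p(0,0) = 0. The optimal cost is written as an infimum (it is attained).\<close>
definition wasserstein :: "real \<Rightarrow> 'a::euclidean_space measure \<Rightarrow> 'a measure \<Rightarrow> real" where
  "wasserstein p m1 m2 =
     (if mass m1 = 0 then 0 else
       (mass m1 * enn2real (INF \<pi>\<in>couplings m1 m2.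
           \<integral>\<^sup>+ z. ennreal (dist (fst z) (snd z) powr p) \<partial>\<pi>)) powr (1 / p))"

definition gen_wasserstein :: "real \<Rightarrow> real \<Rightarrow> real \<Rightarrow> 'a::euclidean_space measure \<Rightarrow> 'a measure \<Rightarrow> real" where
  "gen_wasserstein a b p m1 m2 = Inf {a * tv_dist m1 m1' + a * tv_dist m2 m2' + b * wasserstein p m1' m2' | m1' m2'.
      finite_borel_measure m1' \<and> finite_borel_measure m2' \<and>
      finite_moment p m1' \<and> finite_moment p m2' \<and> mass m1' = mass m2'}"

definition weak_conv :: "(nat \<Rightarrow> 'a::euclidean_space measure) \<Rightarrow> 'a measure \<Rightarrow> bool" where
  "weak_conv ms m \<longleftrightarrow> (\<forall>f :: 'a \<Rightarrow> real. continuous_on UNIV f \<and> compact (closure {x. f x \<noteq> 0}) \<longrightarrow>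
      (\<lambda>n. \<integral>x. f x \<partial>(ms n)) \<longlonglongrightarrow> (\<integral>x. f x \<partial>m))"

definition tight :: "'a::euclidean_space measure set \<Rightarrow> bool" where
  "tight S \<longleftrightarrow> (\<forall>e>0. \<exists>K. compact K \<and> (\<forall>m\<in>S. measure m (space m - K) < e))"

end

theory Submission
  imports Defs
begin

text \<open>
  If \<open>F x \<le> G y + e + L |x - y|\<^sup>p\<close> for all \<open>x, y\<close>, then integrating against a coupling and
  paying for the two total variation terms bounds \<open>\<integral>F d\<mu>\<close> by \<open>\<integral>G d\<nu>\<close> plus \<open>e\<close> times the mass
  of \<open>\<nu>\<close> and an error that vanishes with the generalised Wasserstein distance. With
  \<open>F = G = \<plusminus>f\<close>, where \<open>f\<close> is uniformly continuous, this gives weak convergence; with the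
  indicators of the complements of the balls of radius \<open>R + 1\<close> and \<open>R\<close> it gives tightness.

  Conversely, take a partition of unity \<open>u\<^sub>i\<close> subordinate to small balls and summing to 1 on a compact
  set that carries all the measures up to \<open>\<epsilon>\<close>. Weak convergence gives
  \<open>\<integral>u\<^sub>i d\<mu>\<^sub>n \<rightarrow> \<integral>u\<^sub>i d\<mu>\<close>. Scaling each piece \<open>u\<^sub>i \<mu>\<^sub>n\<close> and \<open>u\<^sub>i \<mu>\<close> down to the smaller of the two
  masses costs little total variation, and the scaled pieces are coupled by their product, which
  moves mass only within one small ball. Using continuous \<open>u\<^sub>i\<close> instead of a partition into sets
  avoids any discussion of sets with null boundary.
\<close>

section \<open>Densities and total variation\<close>

lemma finite_borel_measureD:
  assumes "finite_borel_measure M"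
  shows "finite_measure M" "sets M = sets borel" "space M = UNIV"
  using assms sets_eq_imp_space_eq[of M borel]
  by (auto simp: finite_borel_measure_def intro!: finite_measureI)

lemma integrable_bounded:
  fixes f :: "'b \<Rightarrow> real"
  assumes "finite_measure M" "f \<in> borel_measurable M" "\<And>x. \<bar>f x\<bar> \<le> B"
  shows "integrable M f"
  by (rule finite_measure.integrable_const_bound[OF assms(1), where B=B])
     (use assms in auto)

lemma density_bounded:
  fixes g :: "'b \<Rightarrow> real"
  assumes "finite_measure M" "g \<in> borel_measurable M" "\<And>x. 0 \<le> g x" "\<And>x. g x \<le> B"
  shows "finite_measure (density M g)"
    and "A \<in> sets M \<Longrightarrow> measure (density M g) A = (\<integral>x. g x * indicator A x \<partial>M)"
proof -
  have int: "integrable M g"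
    by (rule integrable_bounded[where B=B]) (use assms in \<open>auto simp: abs_of_nonneg\<close>)
  have em: "emeasure (density M g) A = ennreal (\<integral>x. g x * indicator A x \<partial>M)" if "A \<in> sets M" for A
  proof -
    have "emeasure (density M g) A = (\<integral>\<^sup>+x. ennreal (g x * indicator A x) \<partial>M)"
      using that assms by (subst emeasure_density) (auto intro!: nn_integral_cong split: split_indicator)
    also have "\<dots> = ennreal (\<integral>x. g x * indicator A x \<partial>M)"
      by (rule nn_integral_eq_integral)
         (use int that assms(3) in \<open>auto intro: integrable_real_mult_indicator\<close>)
    finally show ?thesis .
  qed
  show "finite_measure (density M g)"
    by (rule finite_measureI) (simp add: em[OF sets.top])
  show "measure (density M g) A = (\<integral>x. g x * indicator A x \<partial>M)" if "A \<in> sets M"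
    using em[OF that] assms(3) by (simp add: measure_def Bochner_Integration.integral_nonneg)
qed

lemma finite_borel_measure_density:
  fixes g :: "'a::euclidean_space \<Rightarrow> real"
  assumes "finite_borel_measure M" "g \<in> borel_measurable borel" "\<And>x. 0 \<le> g x" "\<And>x. g x \<le> B"
  shows "finite_borel_measure (density M g)"
proof -
  note M = finite_borel_measureD[OF assms(1)]
  have "g \<in> borel_measurable M"
    using assms(2) measurable_cong_sets[OF M(2) refl] by blast
  from density_bounded(1)[OF M(1) this assms(3,4)] have "finite_measure (density M g)" .
  then show ?thesis
    unfolding finite_borel_measure_def using M(2) finite_measure.emeasure_finite by auto
qed

section \<open>Total variation as a supremum over finite disjoint families\<close>

lemma sum_measure_disjoint_le:
  assumes "finite_measure M" "finite P" "P \<subseteq> sets M" "disjoint P"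
  shows "(\<Sum>A\<in>P. measure M A) \<le> measure M (space M)"
proof -
  interpret finite_measure M by fact
  have "(\<Sum>A\<in>P. measure M A) = measure M (\<Union>A\<in>P. A)"
    by (rule finite_measure_finite_Union[symmetric])
       (use assms in \<open>auto simp: disjoint_family_on_def disjoint_def\<close>)
  also have "\<dots> \<le> measure M (space M)"
    by (rule bounded_measure)
  finally show ?thesis .
qed

text \<open>A real \<open>Sup\<close> bounds its elements only if the set is bounded above; here the
  sum of the two masses bounds every partition sum.\<close>

lemma sum_abs_measure_diff_le_tv_dist:
  assumes M: "finite_borel_measure M" and N: "finite_borel_measure N"
    and P: "finite P" "P \<subseteq> sets borel" "disjoint P"
  shows "(\<Sum>A\<in>P. \<bar>measure M A - measure N A\<bar>) \<le> tv_dist M N"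
  unfolding tv_dist_def
proof (rule cSup_upper)
  note M = finite_borel_measureD[OF M] and N = finite_borel_measureD[OF N]
  show "bdd_above {(\<Sum>A\<in>P. \<bar>measure M A - measure N A\<bar>) | P.
       finite P \<and> P \<subseteq> sets borel \<and> disjoint P}"
  proof (rule bdd_aboveI[of _ "mass M + mass N"], clarify)
    fix P :: "'a set set" assume P: "finite P" "P \<subseteq> sets borel" "disjoint P"
    have "(\<Sum>A\<in>P. \<bar>measure M A - measure N A\<bar>) \<le> (\<Sum>A\<in>P. measure M A + measure N A)"
      by (rule sum_mono) (simp add: abs_le_iff add_increasing add_increasing2)
    also have "\<dots> \<le> mass M + mass N"
      unfolding sum.distrib mass_def
      using sum_measure_disjoint_le[OF M(1), of P] sum_measure_disjoint_le[OF N(1), of P] P M N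
      by (intro add_mono) auto
    finally show "(\<Sum>A\<in>P. \<bar>measure M A - measure N A\<bar>) \<le> mass M + mass N" .
  qed
qed (use P in blast)

lemma tv_dist_nonneg:
  assumes "finite_borel_measure M" "finite_borel_measure N"
  shows "0 \<le> tv_dist M N"
  using sum_abs_measure_diff_le_tv_dist[OF assms, of "{}"] by simp

text \<open>What is lost in passing from \<open>M\<close> to its density is the positive measure
  \<open>Q\<close> with density 1 - g. The absolute values therefore disappear, and a disjoint
  family carries at most the total mass of \<open>Q\<close>.\<close>

lemma tv_dist_density_le:
  fixes g :: "'a::euclidean_space \<Rightarrow> real"
  assumes M: "finite_borel_measure M" and g: "g \<in> borel_measurable borel"
    and g01: "\<And>x. 0 \<le> g x" "\<And>x. g x \<le> 1"
  shows "tv_dist M (density M g) \<le> mass M - (\<integral>x. g x \<partial>M)"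
  unfolding tv_dist_def
proof (rule cSup_least)
  note MD = finite_borel_measureD[OF M]
  interpret finite_measure M by (rule MD)
  have g': "g \<in> borel_measurable M"
    using g measurable_cong_sets[OF MD(2) refl] by blast
  define Q where "Q = density M (\<lambda>x. 1 - g x)"
  have Q: "finite_measure Q" "\<And>A. A \<in> sets M \<Longrightarrow> measure Q A = (\<integral>x. (1 - g x) * indicator A x \<partial>M)"
    unfolding Q_def by (rule density_bounded[where B=1]; use MD g' g01 in auto)+
  have eq: "\<bar>measure M A - measure (density M g) A\<bar> = measure Q A" if A: "A \<in> sets borel" for A
  proof -
    have AM: "A \<in> sets M" using A MD by simp
    have ig: "integrable M (\<lambda>x. g x * indicator A x)"
      by (rule integrable_bounded[where B=1])
         (use MD g' AM g01 in \<open>auto simp: abs_mult split: split_indicator\<close>)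
    have "measure Q A = (\<integral>x. indicator A x - g x * indicator A x \<partial>M)"
      unfolding Q(2)[OF AM] by (simp add: algebra_simps)
    also have "\<dots> = measure M A - (\<integral>x. g x * indicator A x \<partial>M)"
      using ig AM by (subst Bochner_Integration.integral_diff) (auto simp: less_top[symmetric])
    also have "(\<integral>x. g x * indicator A x \<partial>M) = measure (density M g) A"
      by (rule density_bounded(2)[symmetric, where B=1]) (use MD g' g01 AM in auto)
    finally show ?thesis using measure_nonneg[of Q A] by linarith
  qed
  have iG: "integrable M g"
    by (rule integrable_bounded[where B=1]) (use MD g' g01 in auto)
  have tot: "measure Q (space Q) = mass M - (\<integral>x. g x \<partial>M)"
    using Q(2)[of UNIV] MD iG Bochner_Integration.integral_diff[OF integrable_const iG, of 1]
    by (simp add: Q_def mass_def)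
  fix y assume "y \<in> {(\<Sum>A\<in>P. \<bar>measure M A - measure (density M g) A\<bar>) | P.
       finite P \<and> P \<subseteq> sets borel \<and> disjoint P}"
  then obtain P where P: "finite P" "P \<subseteq> sets borel" "disjoint P"
    and y: "y = (\<Sum>A\<in>P. \<bar>measure M A - measure (density M g) A\<bar>)" by blast
  have "y = (\<Sum>A\<in>P. measure Q A)"
    unfolding y by (rule sum.cong) (use P eq in auto)
  also have "\<dots> \<le> measure Q (space Q)"
    by (rule sum_measure_disjoint_le) (use Q P MD in \<open>auto simp: Q_def\<close>)
  finally show "y \<le> mass M - (\<integral>x. g x \<partial>M)" using tot by simp
qed (use disjoint_def in blast)

text \<open>Rounding \<open>f\<close> down to multiples of \<open>1 / k\<close> gives a function with finite range,
  whose level sets form one of the partitions in the supremum defining the total variation.\<close>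

lemma integral_diff_le_tv_dist:
  fixes f :: "'a::euclidean_space \<Rightarrow> real"
  assumes M: "finite_borel_measure M" and N: "finite_borel_measure N"
    and f: "f \<in> borel_measurable borel" and fC: "\<And>x. \<bar>f x\<bar> \<le> C"
  shows "\<bar>(\<integral>x. f x \<partial>M) - (\<integral>x. f x \<partial>N)\<bar> \<le> C * tv_dist M N"
proof -
  note MD = finite_borel_measureD[OF M] and ND = finite_borel_measureD[OF N]
  define T where "T = tv_dist M N"
  have T0: "0 \<le> T" unfolding T_def by (rule tv_dist_nonneg[OF M N])
  \<comment> \<open>The rounding error 1/k appears in the sup bound of the rounded function and in
    its distance from \<open>f\<close>, which is paid on both masses. Both contributions vanish as k
    grows.\<close>
  have step: "\<bar>(\<integral>x. f x \<partial>M) - (\<integral>x. f x \<partial>N)\<bar> \<le> (C + 1 / real k) * T + (1 / real k) * (mass M + mass N)"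
    if k: "k > 0" for k :: nat
  proof -
    define g where "g x = real_of_int \<lfloor>real k * f x\<rfloor> / real k" for x
    have g: "g \<in> borel_measurable borel" unfolding g_def using f by measurable
    have gf: "\<bar>f x - g x\<bar> \<le> 1 / real k" for x
    proof -
      have "\<bar>real k * f x - of_int \<lfloor>real k * f x\<rfloor>\<bar> \<le> 1" by linarith
      moreover have "f x - g x = (real k * f x - of_int \<lfloor>real k * f x\<rfloor>) / real k"
        using k by (simp add: g_def field_simps)
      ultimately show ?thesis using k by (simp add: abs_divide divide_right_mono)
    qed
    have gC: "\<bar>g x\<bar> \<le> C + 1 / real k" for x
      using gf[of x] fC[of x] by linarith
    have fin: "finite (range g)"
    proof (rule finite_subset)
      show "range g \<subseteq> (\<lambda>i. real_of_int i / real k) ` {\<lfloor>- (real k * C)\<rfloor>..\<lfloor>real k * C\<rfloor>}"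
      proof (clarify, rule image_eqI)
        fix x
        show "g x = real_of_int \<lfloor>real k * f x\<rfloor> / real k" by (simp add: g_def)
        have "- (real k * C) \<le> real k * f x" "real k * f x \<le> real k * C"
          using fC[of x] mult_left_mono[of "f x" C "real k"] mult_left_mono[of "- C" "f x" "real k"]
          by (auto simp: abs_le_iff)
        then show "\<lfloor>real k * f x\<rfloor> \<in> {\<lfloor>- (real k * C)\<rfloor>..\<lfloor>real k * C\<rfloor>}"
          by (auto intro: floor_mono)
      qed
    qed simp
    have gsum: "(\<integral>x. g x \<partial>Q) = (\<Sum>y\<in>range g. y * measure Q (g -` {y}))"
      if "finite_borel_measure Q" for Q
    proof -
      note QD = finite_borel_measureD[OF that]
      interpret Q: finite_measure Q by (rule QD)
      have vs: "g -` {y} \<in> sets Q" for y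
        using measurable_sets[OF g, of "{y}"] QD by simp
      have "(\<integral>x. g x \<partial>Q) = (\<integral>x. (\<Sum>y\<in>range g. y * indicator (g -` {y}) x) \<partial>Q)"
      proof (rule Bochner_Integration.integral_cong[OF refl])
        fix x
        have "(\<Sum>y\<in>range g. y * indicator (g -` {y}) x) = (\<Sum>y\<in>range g. if y = g x then y else 0)"
          by (rule sum.cong) (auto simp: indicator_def)
        also have "\<dots> = g x" using fin by (simp add: sum.delta')
        finally show "g x = (\<Sum>y\<in>range g. y * indicator (g -` {y}) x)" by simp
      qed
      also have "\<dots> = (\<Sum>y\<in>range g. y * measure Q (g -` {y}))"
        using vs QD by (subst Bochner_Integration.integral_sum) (auto simp: less_top[symmetric])
      finally show ?thesis .
    qed
    have "\<bar>(\<integral>x. g x \<partial>M) - (\<integral>x. g x \<partial>N)\<bar>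
        = \<bar>\<Sum>y\<in>range g. y * (measure M (g -` {y}) - measure N (g -` {y}))\<bar>"
      unfolding gsum[OF M] gsum[OF N] by (simp add: sum_subtractf algebra_simps)
    also have "\<dots> \<le> (\<Sum>y\<in>range g. \<bar>y * (measure M (g -` {y}) - measure N (g -` {y}))\<bar>)"
      by (rule sum_abs)
    also have "\<dots> \<le> (\<Sum>y\<in>range g. (C + 1 / real k) * \<bar>measure M (g -` {y}) - measure N (g -` {y})\<bar>)"
      by (rule sum_mono) (use gC in \<open>auto simp: abs_mult intro!: mult_right_mono\<close>)
    \<comment> \<open>Fibres over distinct values in the range are nonempty and disjoint, hence
      distinct sets, so the sum over values may be reindexed by sets.\<close>
    also have "\<dots> = (C + 1 / real k) * (\<Sum>A\<in>(\<lambda>y. g -` {y}) ` range g. \<bar>measure M A - measure N A\<bar>)"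
      by (subst sum.reindex) (auto simp: inj_on_def sum_distrib_left)
    also have "\<dots> \<le> (C + 1 / real k) * T"
      unfolding T_def
    proof (intro mult_left_mono sum_abs_measure_diff_le_tv_dist M N)
      show "0 \<le> C + 1 / real k" using gC[of 0] by linarith
      show "(\<lambda>y. g -` {y}) ` range g \<subseteq> sets borel"
        using measurable_sets[OF g] by auto
    qed (use fin in \<open>auto simp: disjoint_def\<close>)
    finally have 1: "\<bar>(\<integral>x. g x \<partial>M) - (\<integral>x. g x \<partial>N)\<bar> \<le> (C + 1 / real k) * T" .
    have 2: "\<bar>(\<integral>x. f x \<partial>Q) - (\<integral>x. g x \<partial>Q)\<bar> \<le> (1 / real k) * mass Q" if "finite_borel_measure Q" for Q
    proof -
      note QD = finite_borel_measureD[OF that]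
      interpret Q: finite_measure Q by (rule QD)
      have m: "f \<in> borel_measurable Q" "g \<in> borel_measurable Q"
        using f g measurable_cong_sets[OF QD(2) refl] by blast+
      have i: "integrable Q f" "integrable Q g"
        using integrable_bounded[OF QD(1) m(1) fC] integrable_bounded[OF QD(1) m(2) gC] .
      have "\<bar>(\<integral>x. f x \<partial>Q) - (\<integral>x. g x \<partial>Q)\<bar> = \<bar>\<integral>x. f x - g x \<partial>Q\<bar>" using i by simp
      also have "\<dots> \<le> (\<integral>x. \<bar>f x - g x\<bar> \<partial>Q)" by (rule integral_abs_bound)
      also have "\<dots> \<le> (\<integral>x. 1 / real k \<partial>Q)" using i gf by (intro integral_mono) auto
      also have "\<dots> = (1 / real k) * mass Q" by (simp add: mass_def)
      finally show ?thesis .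
    qed
    show ?thesis using 1 2[OF M] 2[OF N] by (simp add: algebra_simps)
  qed
  have "(\<lambda>k. (C + 1 / real k) * T + (1 / real k) * (mass M + mass N)) \<longlonglongrightarrow> (C + 0) * T + 0 * (mass M + mass N)"
    by (intro tendsto_intros lim_1_over_n)
  then have "(\<lambda>k. (C + 1 / real k) * T + (1 / real k) * (mass M + mass N)) \<longlonglongrightarrow> C * T" by simp
  then show ?thesis unfolding T_def[symmetric]
    by (rule tendsto_lowerbound) (use step in \<open>auto intro!: eventually_sequentiallyI[of 1]\<close>)
qed


section \<open>Coupling the common parts of two measures\<close>

definition overlap :: "'a::euclidean_space measure \<Rightarrow> 'a measure \<Rightarrow> ('a \<Rightarrow> real) \<Rightarrow> real" where
  "overlap M N f = min (\<integral>x. f x \<partial>M) (\<integral>x. f x \<partial>N)"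

text \<open>Where \<open>\<integral>u i dM = 0\<close> the overlap vanishes too, so the junk value of the quotients below is harmless.\<close>

definition common_part ::
    "'a::euclidean_space measure \<Rightarrow> 'a measure \<Rightarrow> 'i set \<Rightarrow> ('i \<Rightarrow> 'a \<Rightarrow> real) \<Rightarrow> 'a measure" where
  "common_part M N I u = density M (\<lambda>x. \<Sum>i\<in>I. overlap M N (u i) / (\<integral>x. u i x \<partial>M) * u i x)"

text \<open>Summand i is the product of the pieces \<open>u i\<close> M and \<open>u i\<close> N,
  each normalised to a probability, weighted by the share of piece i in the total overlap.\<close>

definition overlap_plan ::
    "'a::euclidean_space measure \<Rightarrow> 'a measure \<Rightarrow> 'i set \<Rightarrow> ('i \<Rightarrow> 'a \<Rightarrow> real) \<Rightarrow> ('a \<times> 'a) measure" where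
  "overlap_plan M N I u = density (M \<Otimes>\<^sub>M N) (\<lambda>z. \<Sum>i\<in>I.
     overlap M N (u i) / ((\<integral>x. u i x \<partial>M) * (\<integral>x. u i x \<partial>N) * (\<Sum>j\<in>I. overlap M N (u j)))
       * (u i (fst z) * u i (snd z)))"

lemma overlap_commute: "overlap M N f = overlap N M f"
  by (simp add: overlap_def min.commute)

lemma finite_measure_pair:
  assumes "finite_measure M" "finite_measure N"
  shows "finite_measure (M \<Otimes>\<^sub>M N)"
proof -
  interpret M: finite_measure M by fact
  interpret N: finite_measure N by fact
  show ?thesis
    by (rule finite_measureI)
       (simp add: space_pair_measure N.emeasure_pair_measure_Times ennreal_mult_eq_top_iff)
qed

lemma integral_pair_mult:
  fixes f :: "'b \<Rightarrow> real" and g :: "'c \<Rightarrow> real"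
  assumes M: "finite_measure M" and N: "finite_measure N"
    and [measurable]: "f \<in> borel_measurable M" "g \<in> borel_measurable N"
    and B: "\<And>x. \<bar>f x\<bar> \<le> B" and C: "\<And>x. \<bar>g x\<bar> \<le> C"
  shows "(\<integral>z. f (fst z) * g (snd z) \<partial>(M \<Otimes>\<^sub>M N)) = (\<integral>x. f x \<partial>M) * (\<integral>x. g x \<partial>N)"
proof -
  interpret M: finite_measure M by fact
  interpret N: finite_measure N by fact
  interpret P: pair_sigma_finite M N ..
  have "integrable (M \<Otimes>\<^sub>M N) (\<lambda>z. f (fst z) * g (snd z))"
  proof (rule integrable_bounded[where B="B * C"])
    have "0 \<le> B" using B[of undefined] by linarith
    then show "\<bar>f (fst z) * g (snd z)\<bar> \<le> B * C" for z
      unfolding abs_mult by (intro mult_mono B C) auto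
  qed (auto intro: finite_measure_pair M N)
  from P.integral_fst'[OF this]
  have "(\<integral>z. f (fst z) * g (snd z) \<partial>(M \<Otimes>\<^sub>M N)) = (\<integral>x. \<integral>y. f x * g y \<partial>N \<partial>M)" by simp
  then show ?thesis by simp
qed

text \<open>Conditions on the sum and the supports of the weights enter only lemma by lemma. The
  setting thus covers both a partition of unity and the single weight 1, which yields the product
  coupling.\<close>

locale weighted_pair =
  fixes M N :: "'a::euclidean_space measure" and I :: "'i set" and u :: "'i \<Rightarrow> 'a \<Rightarrow> real"
  assumes M: "finite_borel_measure M" and N: "finite_borel_measure N" and I: "finite I"
    and u[measurable]: "\<And>i. u i \<in> borel_measurable borel"
    and u0: "\<And>i x. 0 \<le> u i x" and u1: "\<And>i x. u i x \<le> 1"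
begin

lemmas MD = finite_borel_measureD[OF M]
lemmas ND = finite_borel_measureD[OF N]

lemma weighted_pair_swap: "weighted_pair N M I u"
  by unfold_locales (use M N I u u0 u1 in auto)

lemma uM[measurable]: "u i \<in> borel_measurable M"
  using u measurable_cong_sets[OF MD(2) refl] by blast

lemma uN[measurable]: "u i \<in> borel_measurable N"
  using u measurable_cong_sets[OF ND(2) refl] by blast

lemma overlap_nonneg: "0 \<le> overlap M N (u i)"
  by (simp add: overlap_def u0 Bochner_Integration.integral_nonneg)

lemma overlap_ratio:
  "0 \<le> overlap M N (u i) / (\<integral>x. u i x \<partial>M)" "overlap M N (u i) / (\<integral>x. u i x \<partial>M) \<le> 1"
proof -
  have "0 \<le> (\<integral>x. u i x \<partial>M)" by (simp add: u0)
  then show "0 \<le> overlap M N (u i) / (\<integral>x. u i x \<partial>M)" "overlap M N (u i) / (\<integral>x. u i x \<partial>M) \<le> 1"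
    using overlap_nonneg[of i] by (auto simp: overlap_def divide_le_eq_1)
qed

lemma overlap_ratio_times: "overlap M N (u i) / (\<integral>x. u i x \<partial>M) * (\<integral>x. u i x \<partial>M) = overlap M N (u i)"
  using overlap_nonneg[of i] by (auto simp: overlap_def)

lemma common_density_bounds:
  "0 \<le> (\<Sum>i\<in>I. overlap M N (u i) / (\<integral>x. u i x \<partial>M) * u i x)"
  "(\<Sum>i\<in>I. overlap M N (u i) / (\<integral>x. u i x \<partial>M) * u i x) \<le> (\<Sum>i\<in>I. u i x)"
  by (intro sum_nonneg mult_nonneg_nonneg overlap_ratio u0)
     (intro sum_mono mult_left_le_one_le overlap_ratio u0)

text \<open>Even with no bound on the sum of the weights, counting the pieces keeps the density
  bounded, as the general facts on densities require.\<close>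

lemma common_density_le_card:
  "(\<Sum>i\<in>I. overlap M N (u i) / (\<integral>x. u i x \<partial>M) * u i x) \<le> real (card I)"
  using common_density_bounds(2)[of x] sum_bounded_above[of I "\<lambda>i. u i x" 1] u1 by fastforce

lemma finite_borel_common_part: "finite_borel_measure (common_part M N I u)"
  unfolding common_part_def
  by (rule finite_borel_measure_density[OF M _ common_density_bounds(1) common_density_le_card]) measurable

lemma integrable_u_indicator: "A \<in> sets M \<Longrightarrow> integrable M (\<lambda>x. u i x * indicator A x)"
  by (rule integrable_bounded[where B=1])
     (use MD u0 u1 in \<open>auto simp: abs_mult split: split_indicator\<close>)

lemma integrable_u: "integrable M (u i)"
  by (rule integrable_bounded[where B=1]) (use MD u0 u1 in auto)

lemma measure_common_part:
  assumes "A \<in> sets borel"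
  shows "measure (common_part M N I u) A =
    (\<Sum>i\<in>I. overlap M N (u i) / (\<integral>x. u i x \<partial>M) * (\<integral>x. u i x * indicator A x \<partial>M))"
proof -
  have AM: "A \<in> sets M" using assms MD by simp
  have "measure (common_part M N I u) A =
      (\<integral>x. (\<Sum>i\<in>I. overlap M N (u i) / (\<integral>x. u i x \<partial>M) * u i x) * indicator A x \<partial>M)"
    unfolding common_part_def
    by (rule density_bounded(2)[OF MD(1) _ common_density_bounds(1) common_density_le_card AM]) measurable
  also have "\<dots> = (\<integral>x. (\<Sum>i\<in>I. overlap M N (u i) / (\<integral>x. u i x \<partial>M) * (u i x * indicator A x)) \<partial>M)"
    by (simp add: sum_distrib_right mult.assoc)
  also have "\<dots> = (\<Sum>i\<in>I. overlap M N (u i) / (\<integral>x. u i x \<partial>M) * (\<integral>x. u i x * indicator A x \<partial>M))"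
    using integrable_u_indicator[OF AM] by simp
  finally show ?thesis .
qed

lemma integral_common_density:
  "(\<integral>x. (\<Sum>i\<in>I. overlap M N (u i) / (\<integral>x. u i x \<partial>M) * u i x) \<partial>M) = (\<Sum>i\<in>I. overlap M N (u i))"
  by (subst Bochner_Integration.integral_sum)
     (auto simp: integrable_u overlap_ratio_times simp del: times_divide_eq_left)

text \<open>Piece i is scaled to weigh exactly its overlap, which is symmetric in \<open>M\<close>
  and \<open>N\<close>. The two common parts therefore have equal mass.\<close>

lemma mass_common_part: "mass (common_part M N I u) = (\<Sum>i\<in>I. overlap M N (u i))"
proof -
  have "space (common_part M N I u) = UNIV" using MD by (simp add: common_part_def)
  then show ?thesis
    unfolding mass_def by (simp add: measure_common_part overlap_ratio_times del: times_divide_eq_left)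
qed

lemma sets_pair: "sets (M \<Otimes>\<^sub>M N) = sets borel" "space (M \<Otimes>\<^sub>M N) = UNIV"
  using sets_pair_measure_cong[OF MD(2) ND(2)] MD(3) ND(3) unfolding borel_prod
  by (auto simp: space_pair_measure)

text \<open>On a rectangle each summand factorises by Fubini; rectangles with one side
  \<open>UNIV\<close> are what \<open>couplings\<close> tests.\<close>

lemma measure_overlap_plan:
  assumes A: "A \<in> sets borel" and B: "B \<in> sets borel"
  shows "finite_measure (overlap_plan M N I u)"
    "measure (overlap_plan M N I u) (A \<times> B) = (\<Sum>i\<in>I.
     overlap M N (u i) / ((\<integral>x. u i x \<partial>M) * (\<integral>x. u i x \<partial>N) * (\<Sum>j\<in>I. overlap M N (u j)))
       * ((\<integral>x. u i x * indicator A x \<partial>M) * (\<integral>x. u i x * indicator B x \<partial>N)))"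
proof -
  define k where "k i = overlap M N (u i) / ((\<integral>x. u i x \<partial>M) * (\<integral>x. u i x \<partial>N) * (\<Sum>j\<in>I. overlap M N (u j)))" for i
  have AB[measurable]: "A \<in> sets M" "B \<in> sets N" using A B MD ND by auto
  have k0: "0 \<le> k i" for i
    unfolding k_def by (intro divide_nonneg_nonneg mult_nonneg_nonneg sum_nonneg overlap_nonneg
      Bochner_Integration.integral_nonneg u0)
  have h0: "0 \<le> (\<Sum>i\<in>I. k i * (u i (fst z) * u i (snd z)))" for z
    by (intro sum_nonneg mult_nonneg_nonneg k0 u0)
  have uu: "0 \<le> u i x * u i y" "u i x * u i y \<le> 1" for i x y
    using u0 u1 by (auto intro: mult_le_one)
  have h1: "(\<Sum>i\<in>I. k i * (u i (fst z) * u i (snd z))) \<le> (\<Sum>i\<in>I. k i)" for z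
    by (intro sum_mono mult_left_le k0 uu)
  have plan: "overlap_plan M N I u = density (M \<Otimes>\<^sub>M N) (\<lambda>z. \<Sum>i\<in>I. k i * (u i (fst z) * u i (snd z)))"
    by (simp add: overlap_plan_def k_def)
  note fP = finite_measure_pair[OF MD(1) ND(1)]
  show "finite_measure (overlap_plan M N I u)"
    unfolding plan by (rule density_bounded(1)[OF fP _ h0 h1]) measurable
  have int: "integrable (M \<Otimes>\<^sub>M N) (\<lambda>z. (u i (fst z) * indicator A (fst z)) * (u i (snd z) * indicator B (snd z)))" for i
    by (rule integrable_bounded[where B=1])
       (use fP uu u0 u1 in \<open>auto simp: abs_mult split: split_indicator\<close>)
  have eq: "(\<integral>z. (u i (fst z) * indicator A (fst z)) * (u i (snd z) * indicator B (snd z)) \<partial>(M \<Otimes>\<^sub>M N))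
      = (\<integral>x. u i x * indicator A x \<partial>M) * (\<integral>x. u i x * indicator B x \<partial>N)" for i
    by (rule integral_pair_mult[where B=1 and C=1])
       (use MD ND u0 u1 in \<open>auto simp: abs_mult split: split_indicator\<close>)
  have "measure (overlap_plan M N I u) (A \<times> B) =
      (\<integral>z. (\<Sum>i\<in>I. k i * (u i (fst z) * u i (snd z))) * indicator (A \<times> B) z \<partial>(M \<Otimes>\<^sub>M N))"
    unfolding plan by (rule density_bounded(2)[OF fP _ h0 h1]) auto
  also have "\<dots> = (\<integral>z. (\<Sum>i\<in>I. k i * ((u i (fst z) * indicator A (fst z)) * (u i (snd z) * indicator B (snd z)))) \<partial>(M \<Otimes>\<^sub>M N))"
    by (rule Bochner_Integration.integral_cong) (auto simp: sum_distrib_left sum_distrib_right indicator_times ac_simps)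
  also have "\<dots> = (\<Sum>i\<in>I. k i * ((\<integral>x. u i x * indicator A x \<partial>M) * (\<integral>x. u i x * indicator B x \<partial>N)))"
    using int by (simp add: eq)
  finally show "measure (overlap_plan M N I u) (A \<times> B) = (\<Sum>i\<in>I.
     overlap M N (u i) / ((\<integral>x. u i x \<partial>M) * (\<integral>x. u i x \<partial>N) * (\<Sum>j\<in>I. overlap M N (u j)))
       * ((\<integral>x. u i x * indicator A x \<partial>M) * (\<integral>x. u i x * indicator B x \<partial>N)))"
    by (simp add: k_def)
qed

text \<open>With \<open>UNIV\<close> as one side of the rectangle, one factor becomes a full
  integral and cancels against the denominator, leaving a common part divided by the total overlap.
  Positivity of that total makes the plan a probability measure.\<close>

lemma overlap_plan_in_couplings:
  assumes pos: "(\<Sum>i\<in>I. overlap M N (u i)) > 0"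
  shows "overlap_plan M N I u \<in> couplings (common_part M N I u) (common_part N M I u)"
proof -
  let ?W = "\<Sum>i\<in>I. overlap M N (u i)"
  interpret sw: weighted_pair N M I u by (rule weighted_pair_swap)
  \<comment> \<open>A vanishing integral forces a vanishing overlap, so the cancellations below
    survive division by zero.\<close>
  have z: "overlap M N (u i) = 0" if "(\<integral>x. u i x \<partial>M) = 0 \<or> (\<integral>x. u i x \<partial>N) = 0" for i
    using that overlap_nonneg[of i] by (auto simp: overlap_def)
  have 1: "measure (overlap_plan M N I u) (A \<times> UNIV) = measure (common_part M N I u) A / mass (common_part M N I u)"
    if A: "A \<in> sets borel" for A
  proof -
    have "overlap M N (u i) / ((\<integral>x. u i x \<partial>M) * (\<integral>x. u i x \<partial>N) * ?W) * ((\<integral>x. u i x * indicator A x \<partial>M) * (\<integral>x. u i x \<partial>N))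
      = overlap M N (u i) / (\<integral>x. u i x \<partial>M) * (\<integral>x. u i x * indicator A x \<partial>M) / ?W" for i
      using z[of i] pos by (cases "(\<integral>x. u i x \<partial>N) = 0") auto
    then show ?thesis
      using A by (simp add: measure_overlap_plan measure_common_part mass_common_part sum_divide_distrib)
  qed
  have 2: "measure (overlap_plan M N I u) (UNIV \<times> A) = measure (common_part N M I u) A / mass (common_part N M I u)"
    if A: "A \<in> sets borel" for A
  proof -
    have "overlap M N (u i) / ((\<integral>x. u i x \<partial>M) * (\<integral>x. u i x \<partial>N) * ?W) * ((\<integral>x. u i x \<partial>M) * (\<integral>x. u i x * indicator A x \<partial>N))
      = overlap M N (u i) / (\<integral>x. u i x \<partial>N) * (\<integral>x. u i x * indicator A x \<partial>N) / ?W" for i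
      using z[of i] pos by (cases "(\<integral>x. u i x \<partial>M) = 0") auto
    then show ?thesis
      using A by (simp add: measure_overlap_plan sw.measure_common_part sw.mass_common_part
          sum_divide_distrib overlap_commute[of N M])
  qed
  have sp: "sets (overlap_plan M N I u) = sets borel" "space (overlap_plan M N I u) = UNIV"
    using sets_pair by (simp_all add: overlap_plan_def)
  have fin: "finite_measure (overlap_plan M N I u)"
    by (rule measure_overlap_plan(1)[of UNIV UNIV]) auto
  have "measure (overlap_plan M N I u) (UNIV \<times> UNIV) = 1"
    using 1[of UNIV] finite_borel_measureD(3)[OF finite_borel_common_part] pos
    by (simp add: mass_def flip: mass_common_part)
  then have "emeasure (overlap_plan M N I u) (space (overlap_plan M N I u)) = 1"
    using fin sp by (simp add: finite_measure.emeasure_eq_measure)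
  then show ?thesis unfolding couplings_def using 1 2 sp by auto
qed

end


section \<open>Integral bounds from the Wasserstein cost\<close>

text \<open>Taking \<open>q\<close> to be \<open>fst\<close> or \<open>snd\<close> serves both
  marginals. The condition on preimages identifies the pushforward of \<open>P\<close> under
  \<open>q\<close> with \<open>M\<close> divided by its mass; the rest is a change of
  variables.\<close>

lemma coupling_marginal:
  fixes M :: "'a::euclidean_space measure"
  assumes M: "finite_borel_measure M" and pos: "mass M > 0"
    and f[measurable]: "f \<in> borel_measurable borel" and fC: "\<And>x. \<bar>f x :: real\<bar> \<le> C"
    and P: "emeasure P (space P) = 1" "sets P = sets borel"
    and q[measurable]: "q \<in> borel_measurable borel"
    and PM: "\<And>A. A \<in> sets borel \<Longrightarrow> measure P (q -` A) = measure M A / mass M"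
  shows "integrable P (\<lambda>z. f (q z))" "(\<integral>z. f (q z) \<partial>P) = (\<integral>x. f x \<partial>M) / mass M"
proof -
  note MD = finite_borel_measureD[OF M]
  interpret M: finite_measure M by (rule MD)
  interpret P: finite_measure P by (rule finite_measureI) (use P in simp)
  have sp: "space P = UNIV" using sets_eq_imp_space_eq[OF P(2)] by simp
  have q'[measurable]: "q \<in> borel_measurable P"
    using q measurable_cong_sets[OF P(2) refl] by blast
  have fM: "f \<in> borel_measurable M"
    using f measurable_cong_sets[OF MD(2) refl] by blast
  show "integrable P (\<lambda>z. f (q z))"
    by (rule integrable_bounded[where B=C]) (use fC P.finite_measure_axioms in auto)
  have "distr P borel q = density M (\<lambda>_. ennreal (1 / mass M))"
  proof (rule measure_eqI)
    fix A assume "A \<in> sets (distr P borel q)"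
    then have A: "A \<in> sets borel" by simp
    then have "emeasure (distr P borel q) A = ennreal (measure M A / mass M)"
      by (simp add: emeasure_distr sp P.emeasure_eq_measure PM)
    also have "\<dots> = ennreal (1 / mass M) * ennreal (measure M A)"
      using pos by (subst ennreal_mult[symmetric]) auto
    also have "\<dots> = emeasure (density M (\<lambda>_. ennreal (1 / mass M))) A"
      using A MD by (simp add: emeasure_density_const M.emeasure_eq_measure)
    finally show "emeasure (distr P borel q) A = emeasure (density M (\<lambda>_. ennreal (1 / mass M))) A" .
  qed (simp add: MD)
  then have "(\<integral>x. f x \<partial>(distr P borel q)) = (\<integral>x. f x \<partial>(density M (\<lambda>_. ennreal (1 / mass M))))"
    by simp
  then show "(\<integral>z. f (q z) \<partial>P) = (\<integral>x. f x \<partial>M) / mass M"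
    using pos fM by (simp add: integral_distr integral_density)
qed

lemma dist_powr_le:
  fixes x y :: "'a::real_normed_vector"
  assumes "p \<ge> 1"
  shows "dist x y powr p \<le> 2 powr p * (norm x powr p + norm y powr p)"
proof -
  have "dist x y \<le> 2 * max (norm x) (norm y)"
    using norm_triangle_ineq4[of x y] by (simp add: dist_norm)
  then have "dist x y powr p \<le> (2 * max (norm x) (norm y)) powr p"
    by (intro powr_mono2) (use assms in auto)
  also have "\<dots> = 2 powr p * max (norm x) (norm y) powr p"
    by (simp add: powr_mult)
  also have "\<dots> \<le> 2 powr p * (norm x powr p + norm y powr p)"
    by (intro mult_left_mono) (auto simp: max_def)
  finally show ?thesis .
qed

lemma dist_powr_measurable:
  "(\<lambda>z :: 'a::euclidean_space \<times> 'a. dist (fst z) (snd z) powr p) \<in> borel_measurable borel"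
  unfolding borel_prod[symmetric] by measurable

text \<open>Finiteness matters because \<open>enn2real\<close> sends infinity to 0 and would turn an
  infinite cost into a zero distance. The normalised product is a coupling, and the p-th moments
  control its cost.\<close>

lemma wasserstein_cost_finite:
  fixes M N :: "'a::euclidean_space measure"
  assumes M: "finite_borel_measure M" and N: "finite_borel_measure N"
    and mom: "finite_moment p M" "finite_moment p N" and p: "p \<ge> 1"
    and mass: "mass M = mass N" and pos: "mass M > 0"
  shows "(INF \<pi>\<in>couplings M N. \<integral>\<^sup>+ z. ennreal (dist (fst z) (snd z) powr p) \<partial>\<pi>) < \<infinity>"
proof -
  \<comment> \<open>With the single weight 1 and equal masses, the overlap is the full mass, both
    common parts are the original measures, and the plan is the normalised product.\<close>
  define u :: "unit \<Rightarrow> 'a \<Rightarrow> real" where "u = (\<lambda>_ _. 1)"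
  interpret weighted_pair M N "UNIV :: unit set" u
    by unfold_locales (use M N in \<open>auto simp: u_def\<close>)
  interpret M: finite_measure M by (rule MD)
  interpret N: finite_measure N by (rule ND)
  have iM: "(\<integral>x. u i x \<partial>M) = mass M" and iN: "(\<integral>x. u i x \<partial>N) = mass M" for i
    using mass by (simp_all add: u_def mass_def)
  have ov: "overlap M N (u i) = mass M" "overlap N M (u i) = mass M" for i
    by (simp_all add: overlap_def iM iN)
  have cM: "common_part M N UNIV u = M" and cN: "common_part N M UNIV u = N"
    unfolding common_part_def ov iM iN using pos by (simp_all add: u_def UNIV_unit density_1)
  have plan: "overlap_plan M N UNIV u = density (M \<Otimes>\<^sub>M N) (\<lambda>_. ennreal (1 / (mass M * mass M)))"
    unfolding overlap_plan_def ov iM iN using pos by (simp add: u_def UNIV_unit field_simps)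
  have mem: "overlap_plan M N UNIV u \<in> couplings M N"
    using overlap_plan_in_couplings pos unfolding cM cN by (simp add: ov UNIV_unit)
  have nmM[measurable]: "(\<lambda>x. ennreal (norm x powr p)) \<in> borel_measurable M"
    by (subst measurable_cong_sets[OF MD(2) refl]) measurable
  have nmN[measurable]: "(\<lambda>x. ennreal (norm x powr p)) \<in> borel_measurable N"
    by (subst measurable_cong_sets[OF ND(2) refl]) measurable
  note mp = measurable_compose[OF measurable_fst nmM, of N] measurable_compose[OF measurable_snd nmN, of M]
  have dm: "(\<lambda>z. ennreal (dist (fst z) (snd z) powr p)) \<in> borel_measurable (M \<Otimes>\<^sub>M N)"
    by (subst measurable_cong_sets[OF sets_pair(1) refl]) (intro measurable_compose[OF dist_powr_measurable] measurable_ennreal)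
  have "(INF \<pi>\<in>couplings M N. \<integral>\<^sup>+ z. ennreal (dist (fst z) (snd z) powr p) \<partial>\<pi>)
      \<le> (\<integral>\<^sup>+ z. ennreal (dist (fst z) (snd z) powr p) \<partial>(overlap_plan M N UNIV u))"
    by (rule INF_lower[OF mem])
  also have "\<dots> = ennreal (1 / (mass M * mass M)) * (\<integral>\<^sup>+ z. ennreal (dist (fst z) (snd z) powr p) \<partial>(M \<Otimes>\<^sub>M N))"
    unfolding plan using dm by (simp add: nn_integral_density nn_integral_cmult)
  also have "\<dots> < \<infinity>"
  proof -
    have "(\<integral>\<^sup>+ z. ennreal (dist (fst z) (snd z) powr p) \<partial>(M \<Otimes>\<^sub>M N))
      \<le> (\<integral>\<^sup>+ z. ennreal (2 powr p) * (ennreal (norm (fst z) powr p) + ennreal (norm (snd z) powr p)) \<partial>(M \<Otimes>\<^sub>M N))"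
      using dist_powr_le[OF p]
      by (intro nn_integral_mono) (simp flip: ennreal_plus ennreal_mult')
    also have "\<dots> = ennreal (2 powr p) * ((\<integral>\<^sup>+ z. ennreal (norm (fst z) powr p) \<partial>(M \<Otimes>\<^sub>M N)) + (\<integral>\<^sup>+ z. ennreal (norm (snd z) powr p) \<partial>(M \<Otimes>\<^sub>M N)))"
      using mp by (simp add: nn_integral_cmult nn_integral_add)
    also have "(\<integral>\<^sup>+ z. ennreal (norm (fst z) powr p) \<partial>(M \<Otimes>\<^sub>M N)) = (\<integral>\<^sup>+ x. ennreal (norm x powr p) \<partial>M) * emeasure N (space N)"
      by (subst N.nn_integral_fst[symmetric, OF mp(1)]) (simp add: nn_integral_multc[OF nmM])
    also have "(\<integral>\<^sup>+ z. ennreal (norm (snd z) powr p) \<partial>(M \<Otimes>\<^sub>M N)) = (\<integral>\<^sup>+ x. ennreal (norm x powr p) \<partial>N) * emeasure M (space M)"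
      by (subst N.nn_integral_fst[symmetric, OF mp(2)]) simp
    also have "ennreal (2 powr p) * ((\<integral>\<^sup>+ x. ennreal (norm x powr p) \<partial>M) * emeasure N (space N) + (\<integral>\<^sup>+ x. ennreal (norm x powr p) \<partial>N) * emeasure M (space M)) < \<infinity>"
      using mom by (simp add: finite_moment_def ennreal_mult_eq_top_iff less_top[symmetric])
    finally show ?thesis by (auto simp: ennreal_mult_less_top)
  qed
  finally show ?thesis .
qed

lemma integral_null_mass:
  assumes "finite_borel_measure M" "mass M = 0"
  shows "(\<integral>x. (f x :: real) \<partial>M) = 0"
proof -
  note MD = finite_borel_measureD[OF assms(1)]
  have "emeasure M (space M) = 0"
    using assms(2) finite_measure.emeasure_eq_measure[OF MD(1), of "space M"] by (simp add: mass_def)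
  then have "AE x in M. f x = 0"
    by (intro AE_I[of _ _ "space M"]) auto
  then show ?thesis by (rule integral_eq_zero_AE)
qed

text \<open>Integrating the pointwise inequality against any coupling bounds its cost below by the
  same number \<open>J\<close>. This passes to the infimum, so no optimal coupling has to be
  produced.\<close>

lemma wasserstein_integral_bound:
  fixes M N :: "'a::euclidean_space measure"
  assumes M: "finite_borel_measure M" and N: "finite_borel_measure N"
    and mom: "finite_moment p M" "finite_moment p N" and p: "p \<ge> 1"
    and mass: "mass M = mass N"
    and F[measurable]: "F \<in> borel_measurable borel" and G[measurable]: "G \<in> borel_measurable borel"
    and FC: "\<And>x. \<bar>F x\<bar> \<le> C" and GC: "\<And>x. \<bar>G x\<bar> \<le> C"
    and L: "L > 0" and FG: "\<And>x y. F x \<le> G y + e + L * dist x y powr p"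
  shows "(\<integral>x. F x \<partial>M) \<le> (\<integral>x. G x \<partial>N) + mass M * e + L * wasserstein p M N powr p"
proof (cases "mass M = 0")
  case True
  then show ?thesis using integral_null_mass[OF M] integral_null_mass[OF N] L mass by simp
next
  case False
  then have pos: "mass M > 0" by (simp add: mass_def less_le)
  define K where "K = (INF \<pi>\<in>couplings M N. \<integral>\<^sup>+ z. ennreal (dist (fst z) (snd z) powr p) \<partial>\<pi>)"
  have Kfin: "K < \<infinity>" unfolding K_def by (rule wasserstein_cost_finite[OF M N mom p mass pos])
  define J where "J = (((\<integral>x. F x \<partial>M) - (\<integral>x. G x \<partial>N)) / mass M - e) / L"
  have "ennreal J \<le> K"
    unfolding K_def
  proof (rule INF_greatest)
    fix P assume "P \<in> couplings M N"
    then have P: "emeasure P (space P) = 1" "sets P = sets borel"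
      and P1: "\<And>A. A \<in> sets borel \<Longrightarrow> measure P (fst -` A) = measure M A / mass M"
      and P2: "\<And>A. A \<in> sets borel \<Longrightarrow> measure P (snd -` A) = measure N A / mass N"
      by (auto simp: couplings_def fst_vimage_eq_Times snd_vimage_eq_Times)
    interpret P: finite_measure P by (rule finite_measureI) (use P in simp)
    have P_1: "measure P (space P) = 1" using P by (simp add: measure_def)
    have dm: "(\<lambda>z. dist (fst z) (snd z) powr p) \<in> borel_measurable P"
      by (subst measurable_cong_sets[OF P(2) refl]) (rule dist_powr_measurable)
    have m1: "fst \<in> borel_measurable (borel :: ('a \<times> 'a) measure)"
      and m2: "snd \<in> borel_measurable (borel :: ('a \<times> 'a) measure)"
      by (intro borel_measurable_continuous_onI continuous_intros)+
    have i1: "integrable P (\<lambda>z. F (fst z))" "(\<integral>z. F (fst z) \<partial>P) = (\<integral>x. F x \<partial>M) / mass M"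
      by (rule coupling_marginal[OF M pos F FC P m1 P1]; assumption)+
    have i2: "integrable P (\<lambda>z. G (snd z))" "(\<integral>z. G (snd z) \<partial>P) = (\<integral>x. G x \<partial>N) / mass N"
      by (rule coupling_marginal[OF N pos[unfolded mass] G GC P m2 P2]; assumption)+
    show "ennreal J \<le> (\<integral>\<^sup>+ z. ennreal (dist (fst z) (snd z) powr p) \<partial>P)"
    proof (cases "(\<integral>\<^sup>+ z. ennreal (dist (fst z) (snd z) powr p) \<partial>P) = \<infinity>")
      case False
      then have id: "integrable P (\<lambda>z. dist (fst z) (snd z) powr p)"
        using dm by (simp add: integrable_iff_bounded less_top[symmetric])
      have "(\<integral>z. F (fst z) \<partial>P) \<le> (\<integral>z. G (snd z) + e + L * dist (fst z) (snd z) powr p \<partial>P)"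
        by (intro integral_mono FG i1 Bochner_Integration.integrable_add i2 integrable_mult_right id P.integrable_const)
      also have "\<dots> = (\<integral>z. G (snd z) \<partial>P) + e + L * (\<integral>z. dist (fst z) (snd z) powr p \<partial>P)"
        using i2(1) id P_1 by simp
      finally have "((\<integral>x. F x \<partial>M) - (\<integral>x. G x \<partial>N)) / mass M - e \<le> (\<integral>z. dist (fst z) (snd z) powr p \<partial>P) * L"
        unfolding i1(2) i2(2) by (simp add: diff_divide_distrib mass mult.commute)
      then have "J \<le> (\<integral>z. dist (fst z) (snd z) powr p \<partial>P)"
        unfolding J_def pos_divide_le_eq[OF L] .
      then show ?thesis
        using nn_integral_eq_integral[OF id] by (simp add: ennreal_leI)
    qed simp
  qed
  \<comment> \<open>\<open>J\<close> may be negative; as \<open>enn2real K\<close> is nonnegative,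
    the comparison in \<open>ennreal\<close> still yields one of reals.\<close>
  then have JK: "J \<le> enn2real K"
    using Kfin by (metis enn2real_nonneg ennreal_enn2real ennreal_le_iff infinity_ennreal_def)
  have "wasserstein p M N powr p = mass M * enn2real K"
    using False p pos by (simp add: wasserstein_def K_def powr_powr)
  moreover have "(\<integral>x. F x \<partial>M) - (\<integral>x. G x \<partial>N) = mass M * (L * J + e)"
    using L pos by (simp add: J_def)
  moreover have "mass M * (L * J) \<le> mass M * (L * enn2real K)"
    using JK L pos by simp
  ultimately show ?thesis by (simp add: algebra_simps)
qed


section \<open>Convergence implies weak convergence and tightness\<close>

definition gen_wasserstein_competitor :: "real \<Rightarrow> 'a::euclidean_space measure \<Rightarrow> 'a measure \<Rightarrow> bool" where
  "gen_wasserstein_competitor p M N \<longleftrightarrow> finite_borel_measure M \<and> finite_borel_measure N \<and>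
      finite_moment p M \<and> finite_moment p N \<and> mass M = mass N"

section \<open>The generalised distance as an infimum of real numbers\<close>

lemma wasserstein_nonneg: "0 \<le> wasserstein p M N"
  by (simp add: wasserstein_def)

lemma gen_wasserstein_value_nonneg:
  assumes "a > 0" "b > 0" "finite_borel_measure M" "finite_borel_measure N"
    and "gen_wasserstein_competitor p M' N'"
  shows "0 \<le> a * tv_dist M M' + a * tv_dist N N' + b * wasserstein p M' N'"
  using assms by (auto simp: gen_wasserstein_competitor_def
    intro!: add_nonneg_nonneg mult_nonneg_nonneg tv_dist_nonneg wasserstein_nonneg)

lemma gen_wasserstein_le:
  assumes "a > 0" "b > 0" "finite_borel_measure M" "finite_borel_measure N"
    and "gen_wasserstein_competitor p M' N'"
  shows "gen_wasserstein a b p M N \<le> a * tv_dist M M' + a * tv_dist N N' + b * wasserstein p M' N'"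
  unfolding gen_wasserstein_def gen_wasserstein_competitor_def[symmetric]
  by (rule cInf_lower)
     (use assms gen_wasserstein_value_nonneg[OF assms(1-4)] in \<open>auto intro!: bdd_belowI[of _ 0]\<close>)

text \<open>Shows that the infimum runs over a nonempty set, without which a real \<open>Inf\<close>
  carries no information.\<close>

lemma gen_wasserstein_competitor_null:
  "gen_wasserstein_competitor p (null_measure borel) (null_measure borel :: 'a::euclidean_space measure)"
  by (simp add: gen_wasserstein_competitor_def finite_borel_measure_def finite_moment_def
      nn_integral_null_measure)

lemma gen_wasserstein_nonneg:
  assumes "a > 0" "b > 0" "finite_borel_measure M" "finite_borel_measure N"
  shows "0 \<le> gen_wasserstein a b p M N"
  unfolding gen_wasserstein_def gen_wasserstein_competitor_def[symmetric]
  by (rule cInf_greatest)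
     (use gen_wasserstein_competitor_null gen_wasserstein_value_nonneg[OF assms] in auto)

lemma gen_wasserstein_lessD:
  assumes "gen_wasserstein a b p M N < r"
  obtains M' N' where "gen_wasserstein_competitor p M' N'"
    "a * tv_dist M M' + a * tv_dist N N' + b * wasserstein p M' N' < r"
proof -
  have "\<exists>y\<in>{a * tv_dist M M' + a * tv_dist N N' + b * wasserstein p M' N' | M' N'.
      gen_wasserstein_competitor p M' N'}. y < r"
    by (rule cInf_lessD)
       (use assms gen_wasserstein_competitor_null in
        \<open>auto simp: gen_wasserstein_def gen_wasserstein_competitor_def\<close>)
  then show ?thesis using that by blast
qed

text \<open>Pass from M to M' to N' to N for a competitor of value below \<open>r\<close>. The outer
  steps cost \<open>C\<close> times total variation, together at most r / a; the middle step is
  \<open>wasserstein_integral_bound\<close> with distance at most r / b.\<close>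

lemma gen_wasserstein_integral_bound:
  fixes M N :: "'a::euclidean_space measure"
  assumes ab: "a > 0" "b > 0" and p: "p \<ge> 1"
    and M: "finite_borel_measure M" and N: "finite_borel_measure N"
    and less: "gen_wasserstein a b p M N < r"
    and F: "F \<in> borel_measurable borel" and G: "G \<in> borel_measurable borel"
    and FC: "\<And>x. \<bar>F x\<bar> \<le> C" and GC: "\<And>x. \<bar>G x\<bar> \<le> C"
    and L: "L > 0" and e: "e \<ge> 0" and FG: "\<And>x y. F x \<le> G y + e + L * dist x y powr p"
  shows "(\<integral>x. F x \<partial>M) \<le> (\<integral>x. G x \<partial>N) + C * (r / a) + (mass N + r / a) * e + L * (r / b) powr p"
proof -
  obtain M' N' where c: "gen_wasserstein_competitor p M' N'"
    and r: "a * tv_dist M M' + a * tv_dist N N' + b * wasserstein p M' N' < r"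
    using gen_wasserstein_lessD[OF less] .
  have M': "finite_borel_measure M'" and N': "finite_borel_measure N'"
    and mom: "finite_moment p M'" "finite_moment p N'" and mass: "mass M' = mass N'"
    using c by (auto simp: gen_wasserstein_competitor_def)
  have C0: "0 \<le> C" using FC[of 0] by linarith
  have t: "0 \<le> a * tv_dist M M'" "0 \<le> a * tv_dist N N'" "0 \<le> b * wasserstein p M' N'"
    using tv_dist_nonneg[OF M M'] tv_dist_nonneg[OF N N'] wasserstein_nonneg[of p M' N'] ab by auto
  have "a * (tv_dist M M' + tv_dist N N') \<le> r" using r t by (simp add: algebra_simps)
  then have tt: "tv_dist M M' + tv_dist N N' \<le> r / a"
    using ab by (simp add: pos_le_divide_eq mult.commute)
  have "b * wasserstein p M' N' \<le> r" using r t by linarith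
  then have w: "wasserstein p M' N' \<le> r / b"
    using ab by (simp add: pos_le_divide_eq mult.commute)
  have wp: "wasserstein p M' N' powr p \<le> (r / b) powr p"
    by (rule powr_mono2) (use w p wasserstein_nonneg in auto)
  \<comment> \<open>The constant test function 1 bounds the mass of the competitor, which multiplies
    \<open>e\<close> in the middle step.\<close>
  have "\<bar>(\<integral>x. 1 \<partial>N) - (\<integral>x. 1 \<partial>N')\<bar> \<le> 1 * tv_dist N N'"
    by (rule integral_diff_le_tv_dist[OF N N']) auto
  then have "mass N' \<le> mass N + r / a"
    using tt tv_dist_nonneg[OF M M'] by (simp add: mass_def)
  then have 1: "mass M' * e \<le> (mass N + r / a) * e"
    using e mass by (simp add: mult_right_mono)
  have 2: "\<bar>(\<integral>x. F x \<partial>M) - (\<integral>x. F x \<partial>M')\<bar> \<le> C * tv_dist M M'"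
    by (rule integral_diff_le_tv_dist[OF M M' F FC])
  have 3: "\<bar>(\<integral>x. G x \<partial>N) - (\<integral>x. G x \<partial>N')\<bar> \<le> C * tv_dist N N'"
    by (rule integral_diff_le_tv_dist[OF N N' G GC])
  have 4: "C * tv_dist M M' + C * tv_dist N N' \<le> C * (r / a)"
    using mult_left_mono[OF tt C0] by (simp add: distrib_left)
  have 5: "L * wasserstein p M' N' powr p \<le> L * (r / b) powr p"
    using wp L by simp
  show ?thesis
    using wasserstein_integral_bound[OF M' N' mom p mass F G FC GC L FG] 1 2 3 4 5 by linarith
qed

text \<open>Supplies a threshold for the distance that depends on the constants of the integral
  bound but not on the index of the sequence.\<close>

lemma error_term_small:
  fixes a b p :: real
  assumes "a > 0" "b > 0" "p \<ge> 1" "(e::real) > 0"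
  obtains r where "r > 0" "A * (r / a) + B * (r / b) powr p < e"
proof -
  have "((\<lambda>r. A * (r / a) + B * (r / b) powr p) \<longlongrightarrow> A * (0 / a) + B * (0 / b) powr p) (at_right 0)"
    using assms eventually_at_right_less[of "0::real"]
    by (intro tendsto_intros tendsto_powr') (auto elim!: eventually_mono)
  then have "((\<lambda>r. A * (r / a) + B * (r / b) powr p) \<longlongrightarrow> 0) (at_right 0)" by simp
  then have "\<forall>\<^sub>F r in at_right 0. A * (r / a) + B * (r / b) powr p < e"
    using assms(4) by (rule order_tendstoD(2))
  moreover have "\<forall>\<^sub>F r in at_right (0::real). r > 0" by (simp add: eventually_at_right_less)
  ultimately have "\<forall>\<^sub>F r in at_right 0. r > 0 \<and> A * (r / a) + B * (r / b) powr p < e"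
    by eventually_elim auto
  then show ?thesis
    using that eventually_happens'[OF trivial_limit_at_right_real] by blast
qed

section \<open>Compactly supported functions and tails of finite measures\<close>

lemma compact_support_bounded:
  fixes f :: "'a::euclidean_space \<Rightarrow> real"
  assumes "continuous_on UNIV f" "compact (closure {x. f x \<noteq> 0})"
  obtains C where "C > 0" "\<And>x. \<bar>f x\<bar> \<le> C"
proof -
  have "bounded (f ` closure {x. f x \<noteq> 0})"
    using assms by (intro compact_imp_bounded compact_continuous_image) (auto intro: continuous_on_subset)
  then obtain C where C: "C > 0" "\<And>x. x \<in> closure {x. f x \<noteq> 0} \<Longrightarrow> \<bar>f x\<bar> \<le> C"
    unfolding bounded_pos by auto
  have "\<bar>f x\<bar> \<le> C" for x
    using C closure_subset[of "{x. f x \<noteq> 0}"] by (cases "f x = 0") auto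
  with C(1) show ?thesis by (rule that)
qed

text \<open>\<open>T\<close> is the closed 1-neighbourhood of the support, which is compact. Two
  points at distance below 1 either both lie in \<open>T\<close> or \<open>f\<close> vanishes at
  both.\<close>

lemma compact_support_uniformly_continuous:
  fixes f :: "'a::euclidean_space \<Rightarrow> real"
  assumes f: "continuous_on UNIV f" and S: "compact (closure {x. f x \<noteq> 0})"
  shows "uniformly_continuous_on UNIV f"
  unfolding uniformly_continuous_on_def
proof (intro allI impI)
  fix e :: real assume e: "e > 0"
  let ?S = "closure {x. f x \<noteq> 0}"
  define T where "T = {x + y | x y. x \<in> ?S \<and> y \<in> cball 0 1}"
  have "compact T" unfolding T_def by (rule compact_sums[OF S compact_cball])
  then have "uniformly_continuous_on T f"
    using f by (intro compact_uniformly_continuous) (auto intro: continuous_on_subset)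
  then obtain d where d: "d > 0" "\<And>x x'. x \<in> T \<Longrightarrow> x' \<in> T \<Longrightarrow> dist x' x < d \<Longrightarrow> dist (f x') (f x) < e"
    unfolding uniformly_continuous_on_def using e by metis
  have T: "y \<in> T" if "f x \<noteq> 0" "dist y x \<le> 1" for x y
  proof -
    have "x \<in> ?S" using that closure_subset[of "{x. f x \<noteq> 0}"] by auto
    moreover have "y = x + (y - x)" "y - x \<in> cball 0 1" using that by (auto simp: dist_norm norm_minus_commute)
    ultimately show ?thesis unfolding T_def by blast
  qed
  show "\<exists>d>0. \<forall>x\<in>UNIV. \<forall>x'\<in>UNIV. dist x' x < d \<longrightarrow> dist (f x') (f x) < e"
  proof (intro exI[of _ "min d 1"] conjI ballI impI)
    fix x x' :: 'a assume "dist x' x < min d 1"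
    then show "dist (f x') (f x) < e"
      using d(2)[of x x'] T[of x x] T[of x x'] T[of x' x] T[of x' x'] e
      by (cases "f x = 0"; cases "f x' = 0") (auto simp: dist_commute)
  qed (use d in auto)
qed

text \<open>Continuity from above along balls of integer radius. Allowing every larger radius lets
  finitely many measures share one ball.\<close>

lemma measure_outside_cball:
  fixes M :: "'a::euclidean_space measure"
  assumes M: "finite_borel_measure M" and e: "e > 0"
  obtains R where "\<And>r. r \<ge> R \<Longrightarrow> measure M (- cball 0 r) < e"
proof -
  note MD = finite_borel_measureD[OF M]
  interpret finite_measure M by (rule MD)
  have "(\<lambda>n. measure M (- cball 0 (real n))) \<longlonglongrightarrow> measure M (\<Inter>n. - cball 0 (real n))"
    by (rule finite_Lim_measure_decseq) (use MD in \<open>auto simp: decseq_def\<close>)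
  moreover have "(\<Inter>n. - cball (0::'a) (real n)) = {}"
    by (auto simp: not_le) (meson not_le real_arch_simple)
  ultimately have "(\<lambda>n. measure M (- cball 0 (real n))) \<longlonglongrightarrow> 0" by simp
  from order_tendstoD(2)[OF this e] obtain n where n: "measure M (- cball 0 (real n)) < e"
    by (auto simp: eventually_sequentially)
  have "measure M (- cball 0 r) < e" if "r \<ge> real n" for r
  proof -
    have "measure M (- cball 0 r) \<le> measure M (- cball 0 (real n))"
      by (rule finite_measure_mono) (use that MD in auto)
    then show ?thesis using n by linarith
  qed
  then show ?thesis by (rule that)
qed

lemma gen_wasserstein_imp_weak_conv:
  fixes ms :: "nat \<Rightarrow> 'a::euclidean_space measure"
  assumes ab: "a > 0" "b > 0" and p: "p \<ge> 1"
    and ms: "\<And>n. finite_borel_measure (ms n)" and m: "finite_borel_measure m"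
    and lim: "(\<lambda>n. gen_wasserstein a b p (ms n) m) \<longlonglongrightarrow> 0"
  shows "weak_conv ms m"
  unfolding weak_conv_def
proof (intro allI impI, elim conjE)
  fix f :: "'a \<Rightarrow> real"
  assume f: "continuous_on UNIV f" and S: "compact (closure {x. f x \<noteq> 0})"
  obtain C where C: "C > 0" "\<And>x. \<bar>f x\<bar> \<le> C" using compact_support_bounded[OF f S] by metis
  have fm: "f \<in> borel_measurable borel" using f by (rule borel_measurable_continuous_onI)
  show "(\<lambda>n. \<integral>x. f x \<partial>(ms n)) \<longlonglongrightarrow> (\<integral>x. f x \<partial>m)"
  proof (rule LIMSEQ_I)
    fix e :: real assume e: "e > 0"
    have m0: "0 \<le> mass m" by (simp add: mass_def)
    \<comment> \<open>Half of \<open>e\<close> is reserved for the oscillation term; the added 1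
      guards against a limit of mass 0.\<close>
    define e0 where "e0 = e / (2 * (mass m + 1))"
    have e0: "e0 > 0" "mass m * e0 \<le> e / 2" using e m0 by (auto simp: e0_def field_simps)
    obtain d where d: "d > 0" "\<And>x y. dist x y < d \<Longrightarrow> \<bar>f x - f y\<bar> < e0"
      using compact_support_uniformly_continuous[OF f S] e0(1)
      unfolding uniformly_continuous_on_def dist_real_def by (metis UNIV_I)
    \<comment> \<open>At distance \<open>d\<close> the penalty \<open>L * d powr p\<close> equals
      2C, the largest possible oscillation of \<open>f\<close>; below \<open>d\<close> uniform
      continuity takes over.\<close>
    define L where "L = 2 * C / d powr p"
    have L: "L > 0" using C d by (simp add: L_def)
    have osc: "\<bar>f x - f y\<bar> \<le> e0 + L * dist x y powr p" for x y
    proof (cases "dist x y < d")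
      case True
      have "0 \<le> L * dist x y powr p" using L by simp
      with d(2)[OF True] show ?thesis by linarith
    next
      case False
      then have "d powr p \<le> dist x y powr p" using d p by (intro powr_mono2) auto
      then have "2 * C \<le> L * dist x y powr p"
        using C d by (simp add: L_def pos_le_divide_eq mult_left_mono)
      then show ?thesis using C(2)[of x] C(2)[of y] e0 by linarith
    qed
    \<comment> \<open>The coefficient of r / a collects \<open>C\<close> from total variation and
      \<open>e0\<close> from the excess mass of the competitor.\<close>
    obtain r where r: "r > 0" "(C + e0) * (r / a) + L * (r / b) powr p < e / 2"
      using error_term_small[OF ab p, of "e / 2" "C + e0" L] e by auto
    have "\<forall>\<^sub>F n in sequentially. gen_wasserstein a b p (ms n) m < r"
      using lim r(1) by (rule order_tendstoD(2))
    then obtain n0 where n0: "\<And>n. n \<ge> n0 \<Longrightarrow> gen_wasserstein a b p (ms n) m < r"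
      by (auto simp: eventually_sequentially)
    have "norm ((\<integral>x. f x \<partial>(ms n)) - (\<integral>x. f x \<partial>m)) < e" if n: "n \<ge> n0" for n
    proof -
      have fg: "f x \<le> f y + e0 + L * dist x y powr p"
        "- f x \<le> - f y + e0 + L * dist x y powr p" for x y
        using osc[of x y] by (auto simp: abs_le_iff)
      have "(\<integral>x. f x \<partial>(ms n)) \<le> (\<integral>x. f x \<partial>m) + C * (r / a) + (mass m + r / a) * e0 + L * (r / b) powr p"
        by (rule gen_wasserstein_integral_bound[OF ab p ms m n0[OF n]])
           (use fm C L e0 fg in auto)
      moreover have "(\<integral>x. - f x \<partial>(ms n)) \<le> (\<integral>x. - f x \<partial>m) + C * (r / a) + (mass m + r / a) * e0 + L * (r / b) powr p"
        by (rule gen_wasserstein_integral_bound[OF ab p ms m n0[OF n]])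
           (use fm C L e0 fg in auto)
      moreover have "C * (r / a) + (mass m + r / a) * e0 + L * (r / b) powr p < e"
      proof -
        have "C * (r / a) + (mass m + r / a) * e0 + L * (r / b) powr p
            = mass m * e0 + ((C + e0) * (r / a) + L * (r / b) powr p)" by algebra
        then show ?thesis using r(2) e0(2) by linarith
      qed
      ultimately show ?thesis by (simp add: abs_less_iff)
    qed
    then show "\<exists>n0. \<forall>n\<ge>n0. norm ((\<integral>x. f x \<partial>(ms n)) - (\<integral>x. f x \<partial>m)) < e" by blast
  qed
qed

lemma gen_wasserstein_imp_tight:
  fixes ms :: "nat \<Rightarrow> 'a::euclidean_space measure"
  assumes ab: "a > 0" "b > 0" and p: "p \<ge> 1"
    and ms: "\<And>n. finite_borel_measure (ms n)" and m: "finite_borel_measure m"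
    and lim: "(\<lambda>n. gen_wasserstein a b p (ms n) m) \<longlonglongrightarrow> 0"
  shows "tight (range ms)"
  unfolding tight_def
proof (intro allI impI)
  fix e :: real assume e: "e > 0"
  obtain R where R: "measure m (- cball 0 R) < e / 2"
    using measure_outside_cball[OF m, of "e / 2"] e by (metis half_gt_zero order_refl)
  obtain r where r: "r > 0" "1 * (r / a) + 1 * (r / b) powr p < e / 2"
    using error_term_small[OF ab p, of "e / 2" 1 1] e by auto
  have "\<forall>\<^sub>F n in sequentially. gen_wasserstein a b p (ms n) m < r"
    using lim r(1) by (rule order_tendstoD(2))
  then obtain n0 where n0: "\<And>n. n \<ge> n0 \<Longrightarrow> gen_wasserstein a b p (ms n) m < r"
    by (auto simp: eventually_sequentially)
  have late: "measure (ms n) (- cball 0 (R + 1)) < e" if n: "n \<ge> n0" for n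
  proof -
    \<comment> \<open>The left side exceeds the first term on the right only if x is outside the
      larger ball and y inside the smaller one; then their distance is at least 1.\<close>
    have step: "indicat_real (- cball 0 (R + 1)) x \<le> indicat_real (- cball 0 R) y + 0 + 1 * dist x y powr p" for x y :: 'a
    proof (cases "norm x > R + 1 \<and> norm y \<le> R")
      case True
      then have "1 \<le> dist x y" using norm_triangle_ineq2[of x y] by (simp add: dist_norm)
      then have "1 \<le> dist x y powr p" using p by (simp add: ge_one_powr_ge_zero)
      then show ?thesis by (simp split: split_indicator)
    qed (auto split: split_indicator)
    have "(\<integral>x. indicat_real (- cball 0 (R + 1)) x \<partial>(ms n))
        \<le> (\<integral>x. indicat_real (- cball 0 R) x \<partial>m) + 1 * (r / a) + (mass m + r / a) * 0 + 1 * (r / b) powr p"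
      by (rule gen_wasserstein_integral_bound[OF ab p ms m n0[OF n] _ _ _ _ _ _ step])
         (auto split: split_indicator)
    then have "measure (ms n) (- cball 0 (R + 1)) \<le> measure m (- cball 0 R) + (1 * (r / a) + 1 * (r / b) powr p)"
      using finite_borel_measureD(3)[OF ms] finite_borel_measureD(3)[OF m] by simp
    then show ?thesis using R r(2) by linarith
  qed
  have "\<exists>Q. \<forall>s\<ge>Q. measure (ms n) (- cball 0 s) < e" for n
    using measure_outside_cball[OF ms e] by metis
  then obtain Q where Q: "\<And>n s. s \<ge> Q n \<Longrightarrow> measure (ms n) (- cball 0 s) < e" by metis
  \<comment> \<open>The finitely many measures before \<open>n0\<close> contribute their own
    radii.\<close>
  define s where "s = Max (insert (R + 1) (Q ` {..<n0}))"
  have "measure (ms n) (space (ms n) - cball 0 s) < e" for n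
  proof (cases "n < n0")
    case True
    then have "s \<ge> Q n" unfolding s_def by (intro Max_ge) auto
    then show ?thesis using Q finite_borel_measureD(3)[OF ms] by (simp add: Compl_eq_Diff_UNIV)
  next
    case False
    have "R + 1 \<le> s" unfolding s_def by (intro Max_ge) auto
    then have "measure (ms n) (- cball 0 s) \<le> measure (ms n) (- cball 0 (R + 1))"
      using finite_borel_measureD[OF ms]
      by (intro finite_measure.finite_measure_mono) auto
    then show ?thesis using late[of n] False finite_borel_measureD(3)[OF ms]
      by (simp add: Compl_eq_Diff_UNIV)
  qed
  then show "\<exists>K. compact K \<and> (\<forall>m\<in>range ms. measure m (space m - K) < e)"
    using compact_cball by blast
qed


section \<open>Weak convergence and tightness imply convergence\<close>

text \<open>Makes compactly supported parts admissible competitors even though the measures they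
  come from may have infinite p-th moment.\<close>

lemma finite_moment_bounded_density:
  fixes g :: "'a::euclidean_space \<Rightarrow> real"
  assumes "finite_borel_measure (density M g)" "g \<in> borel_measurable M" "p \<ge> 0"
    and "\<And>x. g x \<noteq> 0 \<Longrightarrow> norm x \<le> R"
  shows "finite_moment p (density M g)"
proof -
  note D = finite_borel_measureD[OF assms(1)]
  interpret D: finite_measure "density M g" by (rule D)
  have "AE x in density M g. norm x \<le> R"
    using assms by (subst AE_density) (auto intro!: AE_I2)
  then have "AE x in density M g. ennreal (norm x powr p) \<le> ennreal (R powr p)"
    by eventually_elim (use assms in \<open>auto intro!: ennreal_leI powr_mono2\<close>)
  then have "(\<integral>\<^sup>+x. ennreal (norm x powr p) \<partial>(density M g)) \<le> (\<integral>\<^sup>+x. ennreal (R powr p) \<partial>(density M g))"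
    by (rule nn_integral_mono_AE)
  also have "\<dots> < \<infinity>"
    using D.emeasure_finite by (simp add: ennreal_mult_eq_top_iff less_top[symmetric])
  finally show ?thesis unfolding finite_moment_def .
qed

context weighted_pair
begin

text \<open>The plan is concentrated on pairs of points at which a common weight \<open>u i\<close>
  is nonzero, so no mass moves farther than \<open>D\<close>. A zero total overlap falls under the
  convention that the distance is 0.\<close>

lemma wasserstein_common_part_le:
  assumes p: "p \<ge> 1" and D: "D \<ge> 0"
    and diam: "\<And>i x y. i \<in> I \<Longrightarrow> u i x \<noteq> 0 \<Longrightarrow> u i y \<noteq> 0 \<Longrightarrow> dist x y \<le> D"
  shows "wasserstein p (common_part M N I u) (common_part N M I u)
    \<le> (\<Sum>i\<in>I. overlap M N (u i)) powr (1 / p) * D"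
proof (cases "(\<Sum>i\<in>I. overlap M N (u i)) = 0")
  case True
  then show ?thesis by (simp add: wasserstein_def mass_common_part)
next
  case False
  let ?W = "\<Sum>i\<in>I. overlap M N (u i)"
  have pos: "?W > 0" using False sum_nonneg[of I "\<lambda>i. overlap M N (u i)"] overlap_nonneg by force
  note mem = overlap_plan_in_couplings[OF pos]
  define h where "h z = (\<Sum>i\<in>I. overlap M N (u i) / ((\<integral>x. u i x \<partial>M) * (\<integral>x. u i x \<partial>N) * ?W)
       * (u i (fst z) * u i (snd z)))" for z
  have plan: "overlap_plan M N I u = density (M \<Otimes>\<^sub>M N) h"
    by (simp add: overlap_plan_def h_def)
  have hm: "h \<in> borel_measurable (M \<Otimes>\<^sub>M N)" unfolding h_def by measurable
  have supp: "dist (fst z) (snd z) \<le> D" if "h z \<noteq> 0" for z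
  proof -
    have "\<exists>i\<in>I. u i (fst z) * u i (snd z) \<noteq> 0"
    proof (rule sum.not_neutral_contains_not_neutral[OF that[unfolded h_def]])
      fix i
      assume i: "i \<in> I" "overlap M N (u i) / ((\<integral>x. u i x \<partial>M) * (\<integral>x. u i x \<partial>N) * ?W)
        * (u i (fst z) * u i (snd z)) \<noteq> 0"
      from i(2) have "u i (fst z) * u i (snd z) \<noteq> 0"
        by (rule contrapos_nn) (simp only: mult_zero_right)
      with i(1) show ?thesis by blast
    qed
    then show ?thesis using diam by auto
  qed
  have "AE z in overlap_plan M N I u. dist (fst z) (snd z) \<le> D"
    unfolding plan using hm supp by (subst AE_density) (auto intro!: AE_I2)
  then have "AE z in overlap_plan M N I u. ennreal (dist (fst z) (snd z) powr p) \<le> ennreal (D powr p)"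
    by eventually_elim (use p in \<open>auto intro!: ennreal_leI powr_mono2\<close>)
  then have "(\<integral>\<^sup>+z. ennreal (dist (fst z) (snd z) powr p) \<partial>(overlap_plan M N I u))
      \<le> (\<integral>\<^sup>+z. ennreal (D powr p) \<partial>(overlap_plan M N I u))"
    by (rule nn_integral_mono_AE)
  also have "\<dots> = ennreal (D powr p)" using mem by (simp add: couplings_def)
  finally have "(INF \<pi>\<in>couplings (common_part M N I u) (common_part N M I u).
      \<integral>\<^sup>+z. ennreal (dist (fst z) (snd z) powr p) \<partial>\<pi>) \<le> ennreal (D powr p)"
    by (rule INF_lower2[OF mem])
  then have "enn2real (INF \<pi>\<in>couplings (common_part M N I u) (common_part N M I u).
      \<integral>\<^sup>+z. ennreal (dist (fst z) (snd z) powr p) \<partial>\<pi>) \<le> D powr p"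
    by (rule enn2real_leI[rotated]) simp
  then have "wasserstein p (common_part M N I u) (common_part N M I u) \<le> (?W * D powr p) powr (1 / p)"
    unfolding wasserstein_def mass_common_part using pos p
    by (auto intro!: powr_mono2 mult_left_mono)
  also have "\<dots> = ?W powr (1 / p) * D"
    using pos p D by (simp add: powr_mult powr_powr)
  finally show ?thesis .
qed

text \<open>The constant 1 is at most the indicator of the complement of \<open>K\<close> plus the
  sum of the weights, and s - min s t is at most |s - t| for each piece.\<close>

lemma mass_minus_overlap_le:
  assumes K: "compact K" and one: "\<And>x. x \<in> K \<Longrightarrow> (\<Sum>i\<in>I. u i x) = 1"
  shows "mass M - (\<Sum>i\<in>I. overlap M N (u i))
    \<le> measure M (- K) + (\<Sum>i\<in>I. \<bar>(\<integral>x. u i x \<partial>M) - (\<integral>x. u i x \<partial>N)\<bar>)"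
proof -
  interpret finite_measure M by (rule MD)
  have KM: "- K \<in> sets M" using K MD by (simp add: borel_compact borel_comp)
  have "mass M = (\<integral>x. 1 \<partial>M)" by (simp add: mass_def)
  also have "\<dots> \<le> (\<integral>x. indicator (- K) x + (\<Sum>i\<in>I. u i x) \<partial>M)"
  proof (rule integral_mono)
    show "integrable M (\<lambda>x. indicat_real (- K) x + (\<Sum>i\<in>I. u i x))"
      using KM by (intro Bochner_Integration.integrable_add Bochner_Integration.integrable_sum integrable_u)
                  (auto simp: less_top[symmetric])
    show "1 \<le> indicat_real (- K) x + (\<Sum>i\<in>I. u i x)" for x
      using one[of x] sum_nonneg[of I "\<lambda>i. u i x"] u0 by (auto split: split_indicator)
  qed simp
  also have "\<dots> = measure M (- K) + (\<Sum>i\<in>I. \<integral>x. u i x \<partial>M)"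
    using KM by (simp add: integrable_u less_top[symmetric] MD)
  finally have "mass M - (\<Sum>i\<in>I. overlap M N (u i))
      \<le> measure M (- K) + (\<Sum>i\<in>I. (\<integral>x. u i x \<partial>M) - overlap M N (u i))"
    by (simp add: sum_subtractf)
  also have "(\<Sum>i\<in>I. (\<integral>x. u i x \<partial>M) - overlap M N (u i)) \<le> (\<Sum>i\<in>I. \<bar>(\<integral>x. u i x \<partial>M) - (\<integral>x. u i x \<partial>N)\<bar>)"
    by (rule sum_mono) (auto simp: overlap_def min_def)
  finally show ?thesis by simp
qed

text \<open>The common parts serve as competitors: since the weights sum to at most 1, they are
  obtained by densities between 0 and 1, and their total variation cost is just the lost
  mass.\<close>

lemma gen_wasserstein_partition_bound:
  assumes ab: "a > 0" "b > 0" and p: "p \<ge> 1" and D: "D \<ge> 0"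
    and diam: "\<And>i x y. i \<in> I \<Longrightarrow> u i x \<noteq> 0 \<Longrightarrow> u i y \<noteq> 0 \<Longrightarrow> dist x y \<le> D"
    and bnd: "\<And>i x. i \<in> I \<Longrightarrow> u i x \<noteq> 0 \<Longrightarrow> norm x \<le> R"
    and sub: "\<And>x. (\<Sum>i\<in>I. u i x) \<le> 1"
    and K: "compact K" and one: "\<And>x. x \<in> K \<Longrightarrow> (\<Sum>i\<in>I. u i x) = 1"
  shows "gen_wasserstein a b p M N \<le> a * (measure M (- K) + measure N (- K)
      + 2 * (\<Sum>i\<in>I. \<bar>(\<integral>x. u i x \<partial>M) - (\<integral>x. u i x \<partial>N)\<bar>)) + b * (mass N powr (1 / p) * D)"
proof -
  interpret sw: weighted_pair N M I u by (rule weighted_pair_swap)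
  let ?W = "\<Sum>i\<in>I. overlap M N (u i)"
  have W': "(\<Sum>i\<in>I. overlap N M (u i)) = ?W" by (simp add: overlap_commute)
  have nz: "norm x \<le> R" if "(\<Sum>i\<in>I. c i * u i x) \<noteq> 0" for x c
    using sum.not_neutral_contains_not_neutral[OF that] bnd by auto
  have "finite_moment p (common_part M N I u)"
    unfolding common_part_def
    by (rule finite_moment_bounded_density[OF finite_borel_common_part[unfolded common_part_def] _ _ nz], measurable)
       (use p in simp)
  moreover have "finite_moment p (common_part N M I u)"
    unfolding common_part_def
    by (rule finite_moment_bounded_density[OF sw.finite_borel_common_part[unfolded common_part_def] _ _ nz], measurable)
       (use p in simp)
  ultimately have comp: "gen_wasserstein_competitor p (common_part M N I u) (common_part N M I u)"
    by (simp add: gen_wasserstein_competitor_def finite_borel_common_part sw.finite_borel_common_part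
        mass_common_part sw.mass_common_part W')
  have tM: "tv_dist M (common_part M N I u) \<le> mass M - ?W"
    unfolding integral_common_density[symmetric] common_part_def
    by (rule tv_dist_density_le[OF M _ common_density_bounds(1) order_trans[OF common_density_bounds(2) sub]])
       measurable
  have tN: "tv_dist N (common_part N M I u) \<le> mass N - ?W"
    unfolding W'[symmetric] sw.integral_common_density[symmetric] common_part_def
    by (rule tv_dist_density_le[OF N _ sw.common_density_bounds(1) order_trans[OF sw.common_density_bounds(2) sub]])
       measurable
  \<comment> \<open>Bounding the transported mass by that of \<open>N\<close>, the limit in the
    application, keeps the transport term uniform along the sequence.\<close>
  have "?W \<le> mass N"
    using tN tv_dist_nonneg[OF N sw.finite_borel_common_part] by linarith
  then have "?W powr (1 / p) * D \<le> mass N powr (1 / p) * D"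
    using p D overlap_nonneg by (intro mult_right_mono powr_mono2 sum_nonneg) auto
  then have w: "wasserstein p (common_part M N I u) (common_part N M I u) \<le> mass N powr (1 / p) * D"
    by (intro order_trans[OF wasserstein_common_part_le[OF p D]] diam)
  have "gen_wasserstein a b p M N \<le> a * tv_dist M (common_part M N I u) + a * tv_dist N (common_part N M I u)
      + b * wasserstein p (common_part M N I u) (common_part N M I u)"
    by (rule gen_wasserstein_le[OF ab M N comp])
  also have "\<dots> \<le> a * (mass M - ?W) + a * (mass N - ?W) + b * (mass N powr (1 / p) * D)"
    using ab tM tN w by (intro add_mono mult_left_mono) auto
  also have "\<dots> \<le> a * (measure M (- K) + measure N (- K)
      + 2 * (\<Sum>i\<in>I. \<bar>(\<integral>x. u i x \<partial>M) - (\<integral>x. u i x \<partial>N)\<bar>)) + b * (mass N powr (1 / p) * D)"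
    using mass_minus_overlap_le[OF K one] sw.mass_minus_overlap_le[OF K one] ab
    unfolding W' by (simp add: distrib_left[symmetric] abs_minus_commute)
  finally show ?thesis .
qed

end

text \<open>Tents of radius 2d over a finite d-net are divided by max d S rather than by their sum
  S. The denominator stays positive, so the quotients are continuous everywhere and sum to at most
  1. On \<open>K\<close> some centre is closer than d and contributes at least d, so the maximum is
  S and the sum is exactly 1.\<close>

lemma small_partition_of_unity:
  fixes K :: "'a::euclidean_space set"
  assumes K: "compact K" and d: "d > 0"
  obtains I :: "'a set" and u :: "'a \<Rightarrow> 'a \<Rightarrow> real"
  where "finite I" "\<And>i. continuous_on UNIV (u i)" "\<And>i x. 0 \<le> u i x" "\<And>i x. u i x \<le> 1"
    "\<And>i x. u i x \<noteq> 0 \<Longrightarrow> dist i x \<le> 2 * d"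
    "\<And>x. (\<Sum>i\<in>I. u i x) \<le> 1" "\<And>x. x \<in> K \<Longrightarrow> (\<Sum>i\<in>I. u i x) = 1"
proof -
  obtain I where I: "finite I" "K \<subseteq> (\<Union>x\<in>I. ball x d)"
    using compact_imp_seq_compact[OF K, THEN seq_compact_imp_totally_bounded] d by blast
  define v where "v i x = max 0 (2 * d - dist i x)" for i x :: 'a
  define S where "S x = (\<Sum>j\<in>I. v j x)" for x
  \<comment> \<open>The value 0 off \<open>I\<close> makes the bounds hold for every index, as
    \<open>weighted_pair\<close> demands.\<close>
  define u where "u i x = (if i \<in> I then v i x / max d (S x) else 0)" for i x
  have v0: "0 \<le> v i x" for i x by (simp add: v_def)
  have pos: "0 < max d (S x)" for x using d by simp
  have vS: "v i x \<le> S x" if "i \<in> I" for i x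
    unfolding S_def using member_le_sum[OF that, of "\<lambda>j. v j x"] v0 I(1) by simp
  have sum: "(\<Sum>i\<in>I. u i x) = S x / max d (S x)" for x
    by (simp add: u_def S_def sum_divide_distrib)
  show ?thesis
  proof (rule that[OF I(1), of u])
    show "continuous_on UNIV (u i)" for i
    proof (cases "i \<in> I")
      case True
      have "continuous_on UNIV (\<lambda>x. v i x / max d (S x))"
        unfolding S_def v_def using d by (intro continuous_intros) (auto simp: max_def)
      then show ?thesis using True by (simp add: u_def[abs_def])
    qed (simp add: u_def[abs_def])
    show "0 \<le> u i x" for i x
      using v0[of i x] pos[of x] by (simp add: u_def)
    show "u i x \<le> 1" for i x
      using vS[of i x] pos[of x] by (auto simp: u_def divide_le_eq_1)
    show "dist i x \<le> 2 * d" if "u i x \<noteq> 0" for i x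
      using that by (auto simp: u_def v_def max_def split: if_splits)
    show "(\<Sum>i\<in>I. u i x) \<le> 1" for x
      unfolding sum using pos[of x] by (simp add: divide_le_eq_1)
    show "(\<Sum>i\<in>I. u i x) = 1" if x: "x \<in> K" for x
    proof -
      obtain i where i: "i \<in> I" "dist i x < d" using I x by auto
      then have "d \<le> v i x" by (simp add: v_def)
      then have "d \<le> S x" using vS[OF i(1), of x] by linarith
      then show ?thesis unfolding sum using d by simp
    qed
  qed
qed

lemma weak_conv_tight_imp_gen_wasserstein:
  fixes ms :: "nat \<Rightarrow> 'a::euclidean_space measure"
  assumes ab: "a > 0" "b > 0" and p: "p \<ge> 1"
    and ms: "\<And>n. finite_borel_measure (ms n)" and m: "finite_borel_measure m"
    and weak: "weak_conv ms m" and tight: "tight (range ms)"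
  shows "(\<lambda>n. gen_wasserstein a b p (ms n) m) \<longlonglongrightarrow> 0"
proof (rule LIMSEQ_I)
  fix e :: real assume e: "e > 0"
  \<comment> \<open>Two tails below \<open>e1\<close> and twice a sum below e1/4 cost, after
    multiplication by \<open>a\<close>, at most 5e/8; transport adds e/4.\<close>
  define e1 where "e1 = e / (4 * a)"
  have e1: "e1 > 0" using e ab by (simp add: e1_def)
  obtain K1 where "compact K1" "\<forall>Q\<in>range ms. measure Q (space Q - K1) < e1"
    using tight[unfolded tight_def, rule_format, OF e1] by (elim exE conjE)
  then have K1: "compact K1" "\<And>n. measure (ms n) (space (ms n) - K1) < e1"
    by auto
  obtain R where R: "measure m (- cball 0 R) < e1"
    using measure_outside_cball[OF m e1] by (metis order_refl)
  \<comment> \<open>\<open>K1\<close> captures the sequence and the ball captures the limit.\<close>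
  define K where "K = K1 \<union> cball 0 R"
  have K: "compact K" using K1 by (simp add: K_def compact_Un)
  have tail: "measure Q (- K) < e1" if "finite_borel_measure Q" "measure Q (- T) < e1" "compact T" "T \<subseteq> K" for Q T
  proof -
    have "measure Q (- K) \<le> measure Q (- T)"
      using finite_borel_measureD[OF that(1)] that(3,4)
      by (intro finite_measure.finite_measure_mono) (auto simp: borel_compact borel_comp)
    then show ?thesis using that by linarith
  qed
  have tm: "measure m (- K) < e1" by (rule tail[OF m R]) (auto simp: K_def)
  have tms: "measure (ms n) (- K) < e1" for n
    by (rule tail[OF ms, of _ K1])
       (use K1 finite_borel_measureD(3)[OF ms] in \<open>auto simp: K_def Compl_eq_Diff_UNIV\<close>)
  define A where "A = b * mass m powr (1 / p)"
  have A0: "0 \<le> A" using ab by (simp add: A_def)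
  \<comment> \<open>Pieces have diameter at most 4d, so the transport cost
    \<open>A * (4 * d)\<close> stays below e/4; the added 1 covers a limit of mass 0.\<close>
  define d where "d = e / (16 * (A + 1))"
  have d: "d > 0" using e A0 by (simp add: d_def)
  have "A * (4 * d) = e / 4 * (A / (A + 1))" using A0 by (simp add: d_def field_simps)
  also have "\<dots> \<le> e / 4 * 1" using e A0 by (intro mult_left_mono) auto
  finally have Ad: "A * (4 * d) \<le> e / 4" by simp
  obtain I :: "'a set" and u :: "'a \<Rightarrow> 'a \<Rightarrow> real" where I: "finite I"
    and uc: "\<And>i. continuous_on UNIV (u i)" and u01: "\<And>i x. 0 \<le> u i x" "\<And>i x. u i x \<le> 1"
    and us: "\<And>i x. u i x \<noteq> 0 \<Longrightarrow> dist i x \<le> 2 * d"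
    and sub: "\<And>x. (\<Sum>i\<in>I. u i x) \<le> 1" and one: "\<And>x. x \<in> K \<Longrightarrow> (\<Sum>i\<in>I. u i x) = 1"
    using small_partition_of_unity[OF K d] by metis
  have supp: "compact (closure {x. u i x \<noteq> 0})" for i
  proof -
    have "{x. u i x \<noteq> 0} \<subseteq> cball i (2 * d)" using us by auto
    then show ?thesis using bounded_subset[OF bounded_cball] by (simp add: compact_closure)
  qed
  have ci: "(\<lambda>n. \<integral>x. u i x \<partial>(ms n)) \<longlonglongrightarrow> (\<integral>x. u i x \<partial>m)" for i
    using weak uc supp unfolding weak_conv_def by blast
  have "(\<lambda>n. \<Sum>i\<in>I. \<bar>(\<integral>x. u i x \<partial>(ms n)) - (\<integral>x. u i x \<partial>m)\<bar>)
      \<longlonglongrightarrow> (\<Sum>i\<in>I. \<bar>(\<integral>x. u i x \<partial>m) - (\<integral>x. u i x \<partial>m)\<bar>)"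
    by (intro tendsto_intros ci)
  then have "(\<lambda>n. \<Sum>i\<in>I. \<bar>(\<integral>x. u i x \<partial>(ms n)) - (\<integral>x. u i x \<partial>m)\<bar>) \<longlonglongrightarrow> 0" by simp
  moreover have "e1 / 4 > 0" using e1 by simp
  ultimately have "\<forall>\<^sub>F n in sequentially. (\<Sum>i\<in>I. \<bar>(\<integral>x. u i x \<partial>(ms n)) - (\<integral>x. u i x \<partial>m)\<bar>) < e1 / 4"
    by (rule order_tendstoD(2))
  then obtain n0 where n0: "\<And>n. n \<ge> n0 \<Longrightarrow> (\<Sum>i\<in>I. \<bar>(\<integral>x. u i x \<partial>(ms n)) - (\<integral>x. u i x \<partial>m)\<bar>) < e1 / 4"
    by (auto simp: eventually_sequentially)
  \<comment> \<open>A common radius for all supports; inserting 0 covers an empty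
    \<open>I\<close>.\<close>
  define Q where "Q = Max (insert 0 (norm ` I)) + 2 * d"
  have "norm (gen_wasserstein a b p (ms n) m - 0) < e" if n: "n \<ge> n0" for n
  proof -
    interpret weighted_pair "ms n" m I u
      by unfold_locales (use ms m I u01 uc in \<open>auto intro: borel_measurable_continuous_onI\<close>)
    have "gen_wasserstein a b p (ms n) m \<le> a * (measure (ms n) (- K) + measure m (- K)
        + 2 * (\<Sum>i\<in>I. \<bar>(\<integral>x. u i x \<partial>(ms n)) - (\<integral>x. u i x \<partial>m)\<bar>)) + b * (mass m powr (1 / p) * (4 * d))"
    proof (rule gen_wasserstein_partition_bound[OF ab p _ _ _ sub K one, where R=Q])
      show "dist x y \<le> 4 * d" if "i \<in> I" "u i x \<noteq> 0" "u i y \<noteq> 0" for i x y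
        using dist_triangle2[of x y i] us[of i x] us[of i y] that by (simp add: dist_commute)
      show "norm x \<le> Q" if "i \<in> I" "u i x \<noteq> 0" for i x
      proof -
        have "norm i \<le> Max (insert 0 (norm ` I))" using I that by (intro Max_ge) auto
        moreover have "norm x \<le> norm i + dist i x"
          using norm_triangle_ineq2[of x i] by (simp add: dist_norm norm_minus_commute)
        ultimately show ?thesis using us[OF that(2)] by (simp add: Q_def)
      qed
    qed (use d in auto)
    also have "\<dots> \<le> a * (e1 + e1 + 2 * (e1 / 4)) + e / 4"
      using tm tms[of n] n0[OF n] ab Ad by (intro add_mono mult_left_mono) (auto simp: A_def mult.assoc)
    also have "\<dots> < e" using ab e by (simp add: e1_def field_simps)
    finally show ?thesis using gen_wasserstein_nonneg[OF ab ms m, of p n] by simp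
  qed
  then show "\<exists>n0. \<forall>n\<ge>n0. norm (gen_wasserstein a b p (ms n) m - 0) < e" by blast
qed

theorem theorem3:
  fixes a b p :: real and ms :: "nat \<Rightarrow> 'a::euclidean_space measure" and m :: "'a measure"
  assumes "a > 0" "b > 0" "p \<ge> 1"
    and "\<And>n. finite_borel_measure (ms n)" "finite_borel_measure m"
  shows "(\<lambda>n. gen_wasserstein a b p (ms n) m) \<longlonglongrightarrow> 0 \<longleftrightarrow> weak_conv ms m \<and> tight (range ms)"
  using gen_wasserstein_imp_weak_conv[of a b p ms m, OF assms]
    gen_wasserstein_imp_tight[of a b p ms m, OF assms]
    weak_conv_tight_imp_gen_wasserstein[of a b p ms m, OF assms] by blast

end
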